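(* Let $M\in\mathbb{C}^{n\times n}$ be nonzero, let $\varepsilon\in(0,\|M\|)$, and let $q$ be uniformly (Haar) distributed on the unit sphere of $\mathbb{C}^n$. Then $$\Pr\big(|q^*Mq|\le\varepsilon\big)\le\varepsilon^2\log^2\!\big(4e\|M\|/\varepsilon\big)\cdot\frac{5.1\,(n+3)^3}{\sigma_9(M)\,\mathrm{inr}(W(M))}.$$
   Context: $\|\cdot\|$ is the operator norm; $\sigma_9(M)$ is the ninth largest singular value of $M$ (zero if $n<9$); $W(M)=\{x^*Mx:x\in\mathbb{C}^n,\|x\|=1\}$ is the numerical range; $\mathrm{inr}(\cdot)$ is the inner radius of a convex set in $\mathbb{C}$, i.e. the supremum of radii of disks contained in it. The right-hand side is interpreted as $+\infty$ if its denominator vanishes. *)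

theory Defs
  imports
    "HOL-Probability.Probability"
    "HOL-Computational_Algebra.Computational_Algebra"
begin

text \<open>The sesquilinear form is conjugate-linear in its first argument, so that
  \<open>cinner x y\<close> is \<open>x\<^sup>* y\<close>.  (The library's \<open>inner\<close> on \<open>complex ^ 'n\<close> is only the real part.)\<close>

definition cinner :: "complex ^ 'n \<Rightarrow> complex ^ 'n \<Rightarrow> complex"
  where "cinner x y = (\<Sum>i\<in>UNIV. cnj (x $ i) * y $ i)"

definition conj_transpose :: "complex ^ 'n ^ 'm \<Rightarrow> complex ^ 'm ^ 'n"
  where "conj_transpose A = (\<chi> i j. cnj (A $ j $ i))"

definition unitary :: "complex ^ 'n ^ 'n \<Rightarrow> bool"
  where "unitary U \<longleftrightarrow> conj_transpose U ** U = mat 1 \<and> U ** conj_transpose U = mat 1"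

definition op_norm :: "complex ^ 'n ^ 'n \<Rightarrow> real"
  where "op_norm M = onorm (\<lambda>x. M *v x)"

definition charpoly :: "complex ^ 'n ^ 'n \<Rightarrow> complex poly"
  where "charpoly A = det (mat [:0, 1:] - map_matrix (\<lambda>a. [:a:]) A)"

text \<open>Square roots of the eigenvalues of \<open>M\<^sup>* M\<close>, with multiplicity, in decreasing order.
  The eigenvalues are real and nonnegative, so \<open>Re\<close> only changes the type.\<close>

definition singular_values :: "complex ^ 'n ^ 'n \<Rightarrow> real list"
  where "singular_values M =
    rev (sorted_list_of_multiset
      (image_mset (\<lambda>z. sqrt (Re z)) (proots (charpoly (conj_transpose M ** M)))))"

text \<open>\<open>singular_value k M\<close> is the \<open>k\<close>-th largest singular value, counting from \<open>k = 1\<close>.\<close>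

definition singular_value :: "nat \<Rightarrow> complex ^ 'n ^ 'n \<Rightarrow> real"
  where "singular_value k M =
    (if 1 \<le> k \<and> k \<le> length (singular_values M) then singular_values M ! (k - 1) else 0)"

definition numerical_range :: "complex ^ 'n ^ 'n \<Rightarrow> complex set"
  where "numerical_range M = {cinner x (M *v x) | x. norm x = 1}"

text \<open>Radius \<open>0\<close> is admitted (the empty ball), so that sets containing no disk
  have inner radius \<open>0\<close>.\<close>

definition inner_radius :: "complex set \<Rightarrow> ereal"
  where "inner_radius S = Sup {ereal r | r. 0 \<le> r \<and> (\<exists>c. ball c r \<subseteq> S)}"

text \<open>The uniform (Haar) distribution on the unit sphere of \<open>\<complex>\<^sup>n\<close>: the Borel probability measure
  concentrated on the sphere and invariant under the unitary group.  As the unitary group is compact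
  and acts transitively on the sphere, exactly one measure has these properties.\<close>

definition haar_sphere :: "(complex ^ 'n) measure \<Rightarrow> bool"
  where "haar_sphere \<mu> \<longleftrightarrow>
    prob_space \<mu> \<and> sets \<mu> = sets borel \<and> (AE x in \<mu>. norm x = 1) \<and>
    (\<forall>U. unitary U \<longrightarrow> distr \<mu> borel (\<lambda>x. U *v x) = \<mu>)"

end

theory Submission
  imports Defs
begin

text \<open>By uniqueness of the Haar measure, \<open>q\<close> may be taken to be the direction of a standard complex
  Gaussian vector \<open>x\<close> conditioned on \<open>\<parallel>x\<parallel>\<^sup>2 \<le> 2n\<close>, an event of probability at least \<open>1/2\<close>; so it suffices
  to bound the probability of \<open>\<bar>x\<^sup>* M x\<bar> \<le> 2n\<epsilon>\<close>.  The indicator of a disk is dominated by a Gaussian, which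
  is a superposition of characters \<open>exp (i Re (w\<^sup>* z))\<close>, and the modulus of the expectation of
  \<open>exp (i Re (w\<^sup>* x\<^sup>* M x))\<close> is the product of the \<open>1 / sqrt (1 + d\<^sub>i\<^sup>2)\<close> over the eigenvalues \<open>d\<^sub>i\<close> of
  the hermitian part \<open>H\<^sub>w\<close> of \<open>w\<^sup>* M\<close>.  A disk of radius \<open>r\<close> in the numerical range forces an
  eigenvalue of size at least \<open>r \<bar>w\<bar>\<close>.  Two hermitian parts in different directions recover \<open>M\<close>,
  so the fifth largest eigenvalue modulus of \<open>H\<^sub>w\<close> is at least \<open>\<sigma>\<^sub>9 \<bar>w\<bar> / 2\<close> times the sine of the angle between \<open>w\<close>
  and one exceptional direction.  In coordinates adapted to that direction the
  integral over \<open>w\<close> splits; one factor is of order \<open>1 / \<sigma>\<^sub>9\<close>, the other of order \<open>1 / r\<close> up to a logarithm.\<close>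

text \<open>The characteristic function of the form is explicit for Gaussian vectors, whose
  coordinates are independent, but not on the sphere; this is why the sphere is left. Conditioning
  on a ball costs a factor 2 and enlarges the target disk by the factor 2n. The obstacle is that one
  eigenvalue gives only the decay 1/|w|, far from integrable in the plane, and in a bad direction
  the hermitian part may have a single large eigenvalue. The bad directions all lie near one line.
  Along that line the disk in the numerical range supplies the borderline decay, and the cutoff by
  the Gaussian weight turns its divergence into a logarithm. Across it two further eigenvalues,
  supplied by the singular value, give the integrable decay 1/(1 + b^2). The outcome is 64 n^2 times
  a single logarithm. The stated bound follows because a positive ninth singular value forces n to
  be at least 9, and the second logarithm is at least 2.\<close>

unbundle no fps_syntax

section \<open>The spectral theorem for hermitian matrices\<close>

lemma cinner_add_left: "cinner (x + y) z = cinner x z + cinner y z"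
  by (simp add: cinner_def algebra_simps sum.distrib)

lemma cinner_add_right: "cinner x (y + z) = cinner x y + cinner x z"
  by (simp add: cinner_def algebra_simps sum.distrib)

lemma cinner_diff_left: "cinner (x - y) z = cinner x z - cinner y z"
  by (simp add: cinner_def algebra_simps sum_subtractf)

lemma cinner_scale_left: "cinner (c *s x) y = cnj c * cinner x y"
  by (simp add: cinner_def sum_distrib_left mult_ac)

lemma cinner_scale_right: "cinner x (c *s y) = c * cinner x y"
  by (simp add: cinner_def sum_distrib_left mult_ac)

lemma scaleR_eq_scale: fixes x :: "complex ^ 'n" shows "r *\<^sub>R x = complex_of_real r *s x"
  by (simp add: vec_eq_iff scaleR_conv_of_real[where 'a = complex])

lemma cinner_zero_right [simp]: "cinner x 0 = 0"
  by (simp add: cinner_def)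

lemma cinner_commute: "cinner y x = cnj (cinner x y)"
  by (simp add: cinner_def mult_ac)

lemma cinner_self: "cinner x x = complex_of_real ((norm x)\<^sup>2)"
  by (simp add: cinner_def norm_vec_def L2_set_def real_sqrt_pow2 sum_nonneg
      complex_norm_square mult.commute del: of_real_power)

lemma Re_cinner: "Re (cinner x y) = x \<bullet> y"
  by (simp add: cinner_def inner_vec_def inner_complex_def)

lemma cinner_matrix_right: "cinner x (A *v y) = cinner (conj_transpose A *v x) y"
proof -
  have "cinner x (A *v y) = (\<Sum>i\<in>UNIV. \<Sum>j\<in>UNIV. cnj (x $ i) * (A $ i $ j * y $ j))"
    by (simp add: cinner_def matrix_vector_mult_def sum_distrib_left)
  also have "\<dots> = (\<Sum>j\<in>UNIV. \<Sum>i\<in>UNIV. cnj (x $ i) * (A $ i $ j * y $ j))"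
    by (rule sum.swap)
  also have "\<dots> = cinner (conj_transpose A *v x) y"
    by (simp add: cinner_def matrix_vector_mult_def conj_transpose_def sum_distrib_right sum_distrib_left mult_ac)
  finally show ?thesis .
qed

lemma conj_transpose_conj_transpose [simp]: "conj_transpose (conj_transpose A) = A"
  by (simp add: conj_transpose_def vec_eq_iff)

lemma conj_transpose_mult: "conj_transpose (A ** B) = conj_transpose B ** conj_transpose A"
  by (simp add: conj_transpose_def matrix_matrix_mult_def vec_eq_iff mult.commute)

lemma cinner_matrix_left: "cinner (A *v x) y = cinner x (conj_transpose A *v y)"
  by (simp add: cinner_matrix_right)

lemma norm_scale: "norm (c *s x) = cmod c * norm (x :: complex ^ 'n)"
proof -
  have "complex_of_real ((norm (c *s x))\<^sup>2) = complex_of_real ((cmod c * norm x)\<^sup>2)"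
    unfolding cinner_self[symmetric] cinner_scale_left cinner_scale_right
    by (simp add: cinner_self power_mult_distrib complex_norm_square[of c, simplified] mult_ac)
  then have "(norm (c *s x))\<^sup>2 = (cmod c * norm x)\<^sup>2"
    using of_real_eq_iff by blast
  then show ?thesis by (simp add: power2_eq_iff_nonneg)
qed

text \<open>Multiplying \<open>y\<close> by a unimodular phase makes the form real and nonnegative,
  which reduces the claim to the Cauchy-Schwarz inequality of the real inner product.\<close>

lemma cmod_cinner_le: "cmod (cinner x y) \<le> norm x * norm y"
proof (cases "cinner x y = 0")
  case False
  define c where "c = cnj (sgn (cinner x y))"
  have c: "cmod c = 1" using False by (simp add: c_def norm_sgn)
  have "cinner x (c *s y) = complex_of_real (cmod (cinner x y))"
  proof -
    have "cinner x (c *s y) = (cmod (cinner x y))\<^sup>2 / cmod (cinner x y)"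
      by (simp add: cinner_scale_right c_def sgn_eq mult.commute complex_norm_square del: of_real_power)
    then show ?thesis using False by (simp add: power2_eq_square)
  qed
  then have "cmod (cinner x y) = x \<bullet> (c *s y)"
    by (simp flip: Re_cinner)
  also have "\<dots> \<le> norm x * norm (c *s y)"
    by (rule norm_cauchy_schwarz)
  finally show ?thesis by (simp add: norm_scale c)
qed simp

lemma unitary_cinner: "unitary U \<Longrightarrow> cinner (U *v x) (U *v y) = cinner x y"
  by (simp add: cinner_matrix_right matrix_vector_mul_assoc unitary_def)

lemma unitary_norm: "unitary U \<Longrightarrow> norm (U *v x) = norm x"
  using unitary_cinner[of U x x] unfolding cinner_self of_real_eq_iff
  by (simp add: power2_eq_iff_nonneg)

lemma unitary_conj_transpose: "unitary U \<Longrightarrow> unitary (conj_transpose U)"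
  by (simp add: unitary_def)

lemma conj_transpose_mat_1 [simp]: "conj_transpose (mat 1) = mat 1"
  by (auto simp: conj_transpose_def mat_def vec_eq_iff)

lemma unitary_mult:
  assumes "unitary U" "unitary V"
  shows "unitary (U ** V)"
proof -
  have "conj_transpose V ** conj_transpose U ** (U ** V)
      = conj_transpose V ** (conj_transpose U ** U) ** V"
    by (simp add: matrix_mul_assoc)
  moreover have "U ** V ** (conj_transpose V ** conj_transpose U)
      = U ** (V ** conj_transpose V) ** conj_transpose U"
    by (simp add: matrix_mul_assoc)
  ultimately show ?thesis using assms by (simp add: unitary_def conj_transpose_mult)
qed

section \<open>Orthonormal eigenbases of hermitian matrices\<close>

lemma ex_orthogonal:
  fixes F :: "(complex ^ 'n) set"
  assumes "finite F" "card F < CARD('n)"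
  shows "\<exists>x. x \<noteq> 0 \<and> (\<forall>a\<in>F. cinner a x = 0)"
proof -
  obtain f :: "complex ^ 'n \<Rightarrow> 'n" where f: "inj_on f F"
    using card_le_inj[of F "UNIV :: 'n set"] assms by auto
  have "f ` F \<noteq> UNIV"
    using card_image[OF f] assms by auto
  then obtain k where k: "k \<notin> f ` F" by auto
  \<comment> \<open>The conjugated vectors of \<open>F\<close> become rows of a square matrix; an
    index missed by \<open>f\<close> leaves a zero row, so the matrix is singular and a kernel
    vector is orthogonal to all of \<open>F\<close>.\<close>
  define A :: "complex ^ 'n ^ 'n"
    where "A = (\<chi> i j. if i \<in> f ` F then cnj (inv_into F f i $ j) else 0)"
  have "row k A = 0"
    using k by (simp add: A_def row_def vec_eq_iff)
  then have "det A = 0" by (rule det_zero_row)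
  then have "\<not> (\<exists>B. B ** A = mat 1)"
    by (metis invertible_det_nz invertible_left_inverse)
  then obtain x where x: "x \<noteq> 0" "A *v x = 0"
    unfolding matrix_left_invertible_ker by auto
  have "cinner a x = 0" if "a \<in> F" for a
  proof -
    have "(A *v x) $ f a = cinner a x"
      using that f by (simp add: A_def matrix_vector_mult_def cinner_def)
    then show ?thesis using x by simp
  qed
  with x show ?thesis by blast
qed

text \<open>A maximizer of the Rayleigh quotient on the orthogonal complement of \<open>F\<close> is
  an eigenvector. Invariance of the complement places the residual \<open>w\<close> in it, so that
  the maximizer may be varied in the direction \<open>w\<close>.\<close>

lemma hermitian_eigenvector_in_complement:
  fixes H :: "complex ^ 'n ^ 'n"
  assumes H: "conj_transpose H = H" and F: "finite F" "card F < CARD('n)"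
    and inv: "\<And>x. (\<And>a. a \<in> F \<Longrightarrow> cinner a x = 0) \<Longrightarrow> (\<And>a. a \<in> F \<Longrightarrow> cinner a (H *v x) = 0)"
  obtains x and m :: real where "norm x = 1" "\<And>a. a \<in> F \<Longrightarrow> cinner a x = 0"
    "H *v x = complex_of_real m *s x"
proof -
  define V where "V = {x. \<forall>a\<in>F. cinner a x = 0}"
  have V_add: "x + y \<in> V" if "x \<in> V" "y \<in> V" for x y
    using that by (simp add: V_def cinner_add_right)
  have V_scale: "c *s x \<in> V" if "x \<in> V" for x c
    using that by (simp add: V_def cinner_scale_right)
  have cont: "continuous_on UNIV (\<lambda>x. cinner a x)" for a :: "complex ^ 'n"
    unfolding cinner_def by (intro continuous_intros)
  have "V = (\<Inter>a\<in>F. {x. cinner a x = 0})"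
    by (auto simp: V_def)
  moreover have "closed {x. cinner a x = 0}" for a :: "complex ^ 'n"
    by (intro closed_Collect_eq cont continuous_on_const)
  ultimately have "closed V" by (simp add: closed_INT)
  then have comp: "compact (sphere 0 1 \<inter> V)"
    by (intro compact_Int_closed) simp_all
  obtain y where y: "y \<noteq> 0" "y \<in> V"
    using ex_orthogonal[OF F] by (auto simp: V_def)
  have "(1 / complex_of_real (norm y)) *s y \<in> sphere 0 1 \<inter> V"
    using y V_scale by (simp add: norm_scale norm_divide)
  then have ne: "sphere 0 1 \<inter> V \<noteq> {}" by blast
  have "continuous_on (sphere 0 1 \<inter> V) (\<lambda>x. Re (cinner x (H *v x)))"
    unfolding cinner_def matrix_vector_mult_def by (intro continuous_intros)
  from continuous_attains_sup[OF comp ne this]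
  obtain x where x: "norm x = 1" "x \<in> V"
    and max: "\<And>y. norm y = 1 \<Longrightarrow> y \<in> V \<Longrightarrow> Re (cinner y (H *v y)) \<le> Re (cinner x (H *v x))"
    by auto
  define m where "m = Re (cinner x (H *v x))"
  have bound: "Re (cinner y (H *v y)) \<le> m * (norm y)\<^sup>2" if "y \<in> V" for y
  proof (cases "y = 0")
    case False
    define z where "z = complex_of_real (1 / norm y) *s y"
    have z: "norm z = 1" "z \<in> V"
      using False that V_scale by (auto simp: z_def norm_scale norm_divide)
    have "cinner z (H *v z) = complex_of_real (1 / (norm y)\<^sup>2) * cinner y (H *v y)"
      by (simp add: z_def cinner_scale_left cinner_scale_right vec.scale power2_eq_square)
    then have "Re (cinner z (H *v z)) = 1 / (norm y)\<^sup>2 * Re (cinner y (H *v y))"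
      by (simp only: times_complex.sel Re_complex_of_real Im_complex_of_real mult_zero_left diff_zero)
    then have "Re (cinner y (H *v y)) / (norm y)\<^sup>2 \<le> m"
      using max[OF z] unfolding m_def by simp
    then show ?thesis using False by (simp add: field_simps)
  qed simp
  define w where "w = complex_of_real m *s x - H *v x"
  have wV: "w \<in> V"
  proof -
    have "H *v x \<in> V" using inv x(2) by (auto simp: V_def)
    then have "complex_of_real m *s x + (-1) *s (H *v x) \<in> V"
      using x by (intro V_add V_scale)
    then show ?thesis by (simp add: w_def)
  qed
  text \<open>Maximality makes the form \<open>m I - H\<close> nonnegative on \<open>V\<close> with a zero at \<open>x\<close>, so its
    polar form vanishes at \<open>(x, w)\<close>, where it equals \<open>\<parallel>w\<parallel>\<^sup>2\<close>.\<close>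
  have quad: "0 \<le> 2 * t * (norm w)\<^sup>2 + t\<^sup>2 * (m * (norm w)\<^sup>2 - Re (cinner w (H *v w)))" for t :: real
  proof -
    let ?t = "complex_of_real t"
    have Hxw: "cinner x (H *v w) = cinner (H *v x) w"
      by (metis H cinner_matrix_right)
    have "x + ?t *s w \<in> V" using x wV by (intro V_add V_scale)
    from bound[OF this] have "0 \<le> m * (norm (x + ?t *s w))\<^sup>2 - Re (cinner (x + ?t *s w) (H *v (x + ?t *s w)))"
      by simp
    also have "(norm (x + ?t *s w))\<^sup>2 = Re (cinner (x + ?t *s w) (x + ?t *s w))"
      by (simp add: cinner_self)
    also have "\<dots> = 1 + 2 * t * Re (cinner x w) + t\<^sup>2 * (norm w)\<^sup>2"
    proof -
      have "cinner (x + ?t *s w) (x + ?t *s w)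
          = cinner x x + ?t * cinner x w + ?t * cnj (cinner x w) + ?t * ?t * cinner w w"
        by (simp add: cinner_add_left cinner_add_right cinner_scale_left cinner_scale_right
            cinner_commute[of w x] algebra_simps)
      then show ?thesis
        using x(1) by (simp add: cinner_self power2_eq_square)
    qed
    also have "Re (cinner (x + ?t *s w) (H *v (x + ?t *s w)))
        = m + 2 * t * Re (cinner (H *v x) w) + t\<^sup>2 * Re (cinner w (H *v w))"
      using cinner_commute[of w "H *v x"] Hxw
      by (simp add: cinner_add_left cinner_add_right cinner_scale_left cinner_scale_right
          vec.add vec.scale m_def power2_eq_square algebra_simps)
    also have "m * (1 + 2 * t * Re (cinner x w) + t\<^sup>2 * (norm w)\<^sup>2)
        - (m + 2 * t * Re (cinner (H *v x) w) + t\<^sup>2 * Re (cinner w (H *v w)))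
      = 2 * t * Re (cinner w w) + t\<^sup>2 * (m * (norm w)\<^sup>2 - Re (cinner w (H *v w)))"
    proof -
      have "cinner w w = complex_of_real m * cinner x w - cinner (H *v x) w"
        by (subst w_def) (simp add: cinner_diff_left cinner_scale_left)
      then have "Re (cinner w w) = m * Re (cinner x w) - Re (cinner (H *v x) w)" by simp
      then show ?thesis by (simp only:) (simp add: algebra_simps)
    qed
    finally show ?thesis by (simp add: cinner_self)
  qed
  have "norm w = 0"
  proof (rule ccontr)
    assume "norm w \<noteq> 0"
    define p where "p = (norm w)\<^sup>2"
    define c where "c = m * p - Re (cinner w (H *v w))"
    have p: "p > 0" using \<open>norm w \<noteq> 0\<close> by (simp add: p_def)
    have q: "0 \<le> 2 * t * p + t\<^sup>2 * c" for t
      using quad[of t] by (simp add: p_def c_def)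
    have "c \<ge> 0" using bound[OF wV] by (simp add: c_def p_def)
    \<comment> \<open>Negative, and so small that the linear term wins; \<open>c + 1\<close> keeps
      the denominator positive even if \<open>c\<close> vanishes.\<close>
    define t where "t = - p / (c + 1)"
    have "p * (c / (c + 1)) < p * 2"
      using p \<open>c \<ge> 0\<close> by (intro mult_strict_left_mono) (auto simp: field_simps)
    then have "t * (2 * p + t * c) < 0"
      using p \<open>c \<ge> 0\<close> by (intro mult_neg_pos) (auto simp: t_def)
    then show False using q[of t] by (simp add: algebra_simps power2_eq_square)
  qed
  then have "H *v x = complex_of_real m *s x" by (simp add: w_def)
  with x show ?thesis by (intro that[of x m]) (auto simp: V_def)
qed

text \<open>A partial eigenbasis: \<open>u\<close> and \<open>d\<close> are unconstrained off
  \<open>S\<close>, so a frame can be grown one index at a time from prescribed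
  eigenvectors.\<close>

definition eigenframe :: "complex ^ 'n ^ 'n \<Rightarrow> 'n set \<Rightarrow> ('n \<Rightarrow> complex ^ 'n) \<Rightarrow> ('n \<Rightarrow> real) \<Rightarrow> bool"
  where "eigenframe H S u d \<longleftrightarrow>
    (\<forall>i\<in>S. \<forall>j\<in>S. cinner (u i) (u j) = (if i = j then 1 else 0)) \<and>
    (\<forall>i\<in>S. H *v u i = complex_of_real (d i) *s u i)"

text \<open>The orthogonal complement of eigenvectors of a hermitian matrix is invariant, so as long
  as an index is free the complement contains one more eigenvector.\<close>

lemma eigenframe_extend:
  fixes H :: "complex ^ 'n ^ 'n"
  assumes H: "conj_transpose H = H" and S: "eigenframe H S u d"
  obtains u' d' where "eigenframe H UNIV u' d'" "\<And>i. i \<in> S \<Longrightarrow> u' i = u i"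
proof -
  have "\<exists>u' d'. eigenframe H (S \<union> T) u' d' \<and> (\<forall>i\<in>S. u' i = u i)" if "finite T" for T
    using that
  proof (induction T)
    case empty
    then show ?case using S by auto
  next
    case (insert k T)
    then obtain u' d' where u': "eigenframe H (S \<union> T) u' d'" "\<forall>i\<in>S. u' i = u i" by blast
    show ?case
    proof (cases "k \<in> S")
      case True
      then show ?thesis using u' by (metis Un_insert_right insertI1 insert_absorb sup.absorb_iff1 Un_iff)
    next
      case False
      with insert have k: "k \<notin> S \<union> T" by auto
      let ?F = "u' ` (S \<union> T)"
      have "card ?F \<le> card (S \<union> T)" by (intro card_image_le) simp
      also have "\<dots> < CARD('n)" using k by (intro psubset_card_mono) auto
      finally have F: "finite ?F" "card ?F < CARD('n)" by auto
      obtain x m where x: "norm x = 1" "\<And>a. a \<in> ?F \<Longrightarrow> cinner a x = 0"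
        "H *v x = complex_of_real m *s x"
      proof (rule hermitian_eigenvector_in_complement[OF H F])
        fix x a assume *: "\<And>a. a \<in> ?F \<Longrightarrow> cinner a x = 0" and a: "a \<in> ?F"
        then obtain i where i: "i \<in> S \<union> T" "a = u' i" by auto
        have "cinner a (H *v x) = cinner (H *v a) x"
          by (metis H cinner_matrix_right)
        also have "\<dots> = complex_of_real (d' i) * cinner a x"
          using u' i by (simp add: eigenframe_def cinner_scale_left)
        finally show "cinner a (H *v x) = 0" using * a by simp
      qed blast
      have x': "cinner x a = 0" if "a \<in> ?F" for a
        using x(2)[OF that] cinner_commute[of x a] by simp
      have "cinner x x = 1" using x by (simp add: cinner_self)
      then have "eigenframe H (S \<union> insert k T) (u'(k := x)) (d'(k := m))"
        using u'(1) x x' k unfolding eigenframe_def by auto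
      moreover have "\<forall>i\<in>S. (u'(k := x)) i = u i" using u'(2) False by auto
      ultimately show ?thesis by blast
    qed
  qed
  from this[of UNIV] show ?thesis using that by auto
qed

definition diag_matrix :: "('n \<Rightarrow> complex) \<Rightarrow> complex ^ 'n ^ 'n"
  where "diag_matrix d = (\<chi> i j. if i = j then d i else 0)"

lemma diag_matrix_mult_vec: "diag_matrix d *v x = (\<chi> i. d i * x $ i)"
  by (simp add: diag_matrix_def matrix_vector_mult_def vec_eq_iff if_distrib[of "\<lambda>a. a * _"] sum.delta cong: if_cong)

lemma orthonormal_unitary:
  fixes u :: "'n \<Rightarrow> complex ^ 'n"
  assumes "\<And>i j. cinner (u i) (u j) = (if i = j then 1 else 0)"
  shows "unitary (\<chi> k i. u i $ k)"
proof -
  have "conj_transpose (\<chi> k i. u i $ k) ** (\<chi> k i. u i $ k) = mat 1"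
    using assms
    by (simp add: conj_transpose_def matrix_matrix_mult_def vec_eq_iff mat_def cinner_def)
  then show ?thesis unfolding unitary_def using matrix_left_right_inverse by blast
qed

theorem hermitian_spectral:
  fixes H :: "complex ^ 'n ^ 'n"
  assumes H: "conj_transpose H = H"
  obtains U d where "unitary U" "H = U ** diag_matrix (\<lambda>i. complex_of_real (d i)) ** conj_transpose U"
proof -
  have "eigenframe H {} (\<lambda>_. 0) (\<lambda>_. 0)" by (simp add: eigenframe_def)
  from eigenframe_extend[OF H this] obtain u d where u: "eigenframe H UNIV u d" by blast
  define U where "U = (\<chi> k i. u i $ k)"
  have U: "unitary U"
    unfolding U_def using u by (intro orthonormal_unitary) (auto simp: eigenframe_def)
  have "H ** U = U ** diag_matrix (\<lambda>i. complex_of_real (d i))"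
  proof -
    have "(\<Sum>k\<in>UNIV. H $ l $ k * u i $ k) = complex_of_real (d i) * u i $ l" for i l
    proof -
      have "(H *v u i) $ l = (complex_of_real (d i) *s u i) $ l"
        using u by (simp add: eigenframe_def)
      then show ?thesis by (simp add: matrix_vector_mult_def)
    qed
    then show ?thesis
      by (simp add: U_def diag_matrix_def matrix_matrix_mult_def vec_eq_iff
          if_distrib[of "\<lambda>a. _ * a"] sum.delta' mult.commute cong: if_cong)
  qed
  then have "H = U ** diag_matrix (\<lambda>i. complex_of_real (d i)) ** conj_transpose U"
    using U by (metis unitary_def matrix_mul_assoc matrix_mul_rid)
  with U show ?thesis by (rule that)
qed

section \<open>Transitivity of the unitary group on the sphere\<close>

lemma unitary_maps_axis:
  fixes x :: "complex ^ 'n"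
  assumes x: "norm x = 1"
  obtains U where "unitary U" "U *v axis k 1 = x"
proof -
  \<comment> \<open>Every orthonormal family is an eigenframe of the identity, so extending
    eigenframes also completes a unit vector to an orthonormal basis.\<close>
  have "eigenframe (mat 1) {k} (\<lambda>_. x) (\<lambda>_. 1)"
    using x by (simp add: eigenframe_def cinner_self)
  from eigenframe_extend[OF _ this] obtain u d
    where u: "eigenframe (mat 1 :: complex ^ 'n ^ 'n) UNIV u d" "u k = x"
    by auto
  have "unitary (\<chi> l i. u i $ l)"
    using u by (intro orthonormal_unitary) (auto simp: eigenframe_def)
  moreover have "(\<chi> l i. u i $ l) *v axis k 1 = x"
    using u by (simp add: matrix_vector_mult_def axis_def vec_eq_iff
        if_distrib[of "\<lambda>a. _ * a"] sum.delta' cong: if_cong)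
  ultimately show ?thesis by (rule that)
qed

lemma unitary_transitive:
  fixes x y :: "complex ^ 'n"
  assumes "norm x = 1" "norm y = 1"
  obtains U where "unitary U" "U *v x = y"
proof -
  obtain X where X: "unitary X" "X *v axis undefined 1 = x" using unitary_maps_axis[OF assms(1)] .
  obtain Y where Y: "unitary Y" "Y *v axis undefined 1 = y" using unitary_maps_axis[OF assms(2)] .
  have "conj_transpose X *v x = axis undefined 1"
    using X by (metis matrix_vector_mul_assoc unitary_def matrix_vector_mul_lid)
  then have "(Y ** conj_transpose X) *v x = y"
    using Y by (metis matrix_vector_mul_assoc)
  then show ?thesis using that X Y unitary_mult unitary_conj_transpose by blast
qed

section \<open>Singular values and hermitian parts\<close>

text \<open>Take the largest attained value with at least \<open>k\<close> indices at or above it.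
  If \<open>k\<close> indices were strictly above, the smallest of their values would be a larger
  candidate. Counting in place of sorting handles ties.\<close>

lemma ex_kth_largest:
  fixes f :: "'n :: finite \<Rightarrow> real"
  assumes k: "1 \<le> k" "k \<le> CARD('n)"
  obtains s where "s \<in> range f" "k \<le> card {i. s \<le> f i}" "card {i. s < f i} < k"
proof -
  define A where "A = {t \<in> range f. k \<le> card {i. t \<le> f i}}"
  have all: "{i. Min (range f) \<le> f i} = UNIV" by auto
  have "k \<le> card {i. Min (range f) \<le> f i}" unfolding all by (rule k(2))
  moreover have "Min (range f) \<in> range f" by (rule Min_in) auto
  ultimately have "Min (range f) \<in> A" unfolding A_def by blast
  moreover have "finite A" by (simp add: A_def)
  ultimately have A: "finite A" "A \<noteq> {}" by blast+
  define s where "s = Max A"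
  have s: "s \<in> A" unfolding s_def using A by (rule Max_in)
  have "card {i. s < f i} < k"
  proof (rule ccontr)
    assume *: "\<not> card {i. s < f i} < k"
    let ?B = "f ` {i. s < f i}"
    have "{i. s < f i} \<noteq> {}" using * k by (metis card.empty less_eq_Suc_le One_nat_def)
    then have t: "Min ?B \<in> ?B" by (intro Min_in) auto
    have "card {i. s < f i} \<le> card {i. Min ?B \<le> f i}" by (intro card_mono) auto
    then have "Min ?B \<in> A" using t * by (auto simp: A_def)
    then have "Min ?B \<le> s" unfolding s_def using A by simp
    then show False using t by auto
  qed
  then show ?thesis using s that by (auto simp: A_def)
qed

lemma norm_diag_matrix: "(norm (diag_matrix d *v x))\<^sup>2 = (\<Sum>i\<in>UNIV. (cmod (d i))\<^sup>2 * (cmod (x $ i))\<^sup>2)"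
  by (simp add: diag_matrix_mult_vec norm_vec_def L2_set_def sum_nonneg norm_mult power_mult_distrib)

lemma cinner_diag_matrix:
  "cinner x (diag_matrix (\<lambda>i. complex_of_real (d i)) *v x) = complex_of_real (\<Sum>i\<in>UNIV. d i * (cmod (x $ i))\<^sup>2)"
  by (simp add: diag_matrix_mult_vec cinner_def complex_norm_square mult_ac del: of_real_power)

lemma norm_vec_cmod: "(norm (x :: complex ^ 'n))\<^sup>2 = (\<Sum>i\<in>UNIV. (cmod (x $ i))\<^sup>2)"
  by (simp add: norm_vec_def L2_set_def sum_nonneg)

lemma cinner_column: "cinner (column i U) x = (conj_transpose U *v x) $ i"
  by (simp add: cinner_def column_def conj_transpose_def matrix_vector_mult_def)

text \<open>In the eigenbasis \<open>x\<close> has no component along eigenvalues of modulus above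
  \<open>s\<close>. This turns a count of large eigenvalues into a number of linear conditions on
  \<open>x\<close>.\<close>

lemma hermitian_small_on_complement:
  fixes H :: "complex ^ 'n ^ 'n"
  assumes U: "unitary U" and H: "H = U ** diag_matrix (\<lambda>i. complex_of_real (d i)) ** conj_transpose U"
    and x: "\<And>i. s < \<bar>d i\<bar> \<Longrightarrow> cinner (column i U) x = 0" and s: "s \<ge> 0"
  shows "norm (H *v x) \<le> s * norm x"
proof -
  define y where "y = conj_transpose U *v x"
  have y0: "y $ i = 0" if "s < \<bar>d i\<bar>" for i
    using x[OF that] by (simp add: cinner_column y_def)
  have ny: "norm y = norm x" unfolding y_def using U by (intro unitary_norm unitary_conj_transpose)
  have "H *v x = U *v (diag_matrix (\<lambda>i. complex_of_real (d i)) *v y)"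
    by (simp add: H y_def matrix_vector_mul_assoc matrix_mul_assoc)
  then have "norm (H *v x) = norm (diag_matrix (\<lambda>i. complex_of_real (d i)) *v y)"
    using U by (simp add: unitary_norm)
  then have "(norm (H *v x))\<^sup>2 = (\<Sum>i\<in>UNIV. (d i)\<^sup>2 * (cmod (y $ i))\<^sup>2)"
    by (simp add: norm_diag_matrix)
  also have "\<dots> \<le> (\<Sum>i\<in>UNIV. s\<^sup>2 * (cmod (y $ i))\<^sup>2)"
  proof (rule sum_mono)
    fix i
    show "(d i)\<^sup>2 * (cmod (y $ i))\<^sup>2 \<le> s\<^sup>2 * (cmod (y $ i))\<^sup>2"
      using y0[of i] s by (cases "s < \<bar>d i\<bar>") (auto intro!: mult_right_mono simp: abs_le_square_iff[symmetric])
  qed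
  also have "\<dots> = (s * norm x)\<^sup>2"
    by (simp add: power_mult_distrib norm_vec_cmod flip: ny sum_distrib_left)
  finally show ?thesis using s by (simp add: power2_le_iff_abs_le)
qed

lemma hermitian_quadratic_le:
  fixes H :: "complex ^ 'n ^ 'n"
  assumes U: "unitary U" and H: "H = U ** diag_matrix (\<lambda>i. complex_of_real (d i)) ** conj_transpose U"
    and s: "\<And>i. \<bar>d i\<bar> \<le> s" and s0: "s \<ge> 0"
  shows "cmod (cinner x (H *v x)) \<le> s * (norm x)\<^sup>2"
proof -
  have "norm (H *v x) \<le> s * norm x"
    using hermitian_small_on_complement[OF U H _ s0, of x] s by (metis not_less)
  then have "norm x * norm (H *v x) \<le> norm x * (s * norm x)"
    by (intro mult_left_mono) auto
  then show ?thesis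
    using cmod_cinner_le[of x "H *v x"] by (simp add: power2_eq_square mult_ac)
qed

section \<open>Characteristic polynomials and singular values\<close>

lemma map_matrix_const_mult:
  fixes A B :: "complex ^ 'n ^ 'n"
  shows "map_matrix (\<lambda>a. [:a:]) (A ** B) = map_matrix (\<lambda>a. [:a:]) A ** map_matrix (\<lambda>a. [:a:]) B"
proof -
  have "(\<Sum>k\<in>S. [:f k:]) = [:\<Sum>k\<in>S. f k:]" for f :: "'n \<Rightarrow> complex" and S
    by (induction S rule: infinite_finite_induct) auto
  then show ?thesis
    by (simp add: vec_eq_iff matrix_matrix_mult_def mult.commute)
qed

lemma matrix_diff_ldistrib: "A ** (B - C) = A ** B - A ** (C :: 'a :: ring_1 ^ 'n ^ 'm)"
  by (simp add: matrix_matrix_mult_def vec_eq_iff algebra_simps sum_subtractf)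

lemma matrix_diff_rdistrib: "(A - B) ** C = A ** C - B ** (C :: 'a :: ring_1 ^ 'n ^ 'm)"
  by (simp add: matrix_matrix_mult_def vec_eq_iff algebra_simps sum_subtractf)

text \<open>The similarity is carried out over polynomial matrices: the embedding of constants is
  multiplicative and the scalar matrix of the variable commutes with everything, so the two outer
  determinants cancel.\<close>

lemma charpoly_diagonalized:
  fixes H :: "complex ^ 'n ^ 'n"
  assumes U: "unitary U" and H: "H = U ** diag_matrix d ** conj_transpose U"
  shows "charpoly H = (\<Prod>i\<in>UNIV. [:- d i, 1:])"
proof -
  let ?P = "map_matrix (\<lambda>a::complex. [:a:]) :: complex ^ 'n ^ 'n \<Rightarrow> complex poly ^ 'n ^ 'n"
  have one: "?P (mat 1) = mat 1" by (auto simp: vec_eq_iff mat_def one_pCons)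
  have inv: "?P U ** ?P (conj_transpose U) = mat 1"
    using U by (simp add: unitary_def one flip: map_matrix_const_mult)
  have X: "mat [:0, 1:] ** A = A ** mat [:0, 1:]" for A :: "complex poly ^ 'n ^ 'n"
    by (simp add: vec_eq_iff matrix_matrix_mult_def mat_def if_distrib[of "\<lambda>a. a * _"] if_distrib[of "\<lambda>a. _ * a"]
        sum.delta sum.delta' mult.commute cong: if_cong)
  have "mat [:0, 1:] - ?P H = ?P U ** (mat [:0, 1:] - ?P (diag_matrix d)) ** ?P (conj_transpose U)"
  proof -
    have "?P U ** mat [:0, 1:] ** ?P (conj_transpose U) = mat [:0, 1:] ** (?P U ** ?P (conj_transpose U))"
      by (metis X matrix_mul_assoc)
    then show ?thesis
      by (simp add: H map_matrix_const_mult inv matrix_diff_ldistrib matrix_diff_rdistrib)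
  qed
  then have "charpoly H = det (?P U) * det (mat [:0, 1:] - ?P (diag_matrix d)) * det (?P (conj_transpose U))"
    by (simp add: charpoly_def det_mul)
  also have "\<dots> = det (mat [:0, 1:] - ?P (diag_matrix d)) * det (?P U ** ?P (conj_transpose U))"
    by (simp add: det_mul)
  also have "\<dots> = det (mat [:0, 1:] - ?P (diag_matrix d))"
    by (simp add: inv)
  also have "\<dots> = (\<Prod>i\<in>UNIV. (mat [:0, 1:] - ?P (diag_matrix d)) $ i $ i)"
    by (rule det_diagonal) (simp add: diag_matrix_def mat_def)
  also have "\<dots> = (\<Prod>i\<in>UNIV. [:- d i, 1:])"
    by (simp add: diag_matrix_def mat_def)
  finally show ?thesis .
qed

text \<open>Spectral theorem for \<open>conj_transpose M ** M\<close>: the columns of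
  \<open>U\<close> are right singular vectors and \<open>d\<close> holds the squared singular
  values. The multiset equation leaves their order open.\<close>

lemma singular_value_decomposition:
  fixes M :: "complex ^ 'n ^ 'n"
  obtains U d where "unitary U"
    "\<forall>x. (norm (M *v x))\<^sup>2 = (\<Sum>i\<in>UNIV. d i * (cmod ((conj_transpose U *v x) $ i))\<^sup>2)"
    "mset (singular_values M) = image_mset (\<lambda>i. sqrt (d i)) (mset_set UNIV)"
proof -
  have "conj_transpose (conj_transpose M ** M) = conj_transpose M ** M"
    by (simp add: conj_transpose_mult)
  then obtain U d where U: "unitary U"
    and d: "conj_transpose M ** M = U ** diag_matrix (\<lambda>i. complex_of_real (d i)) ** conj_transpose U"
    by (rule hermitian_spectral)
  have "(norm (M *v x))\<^sup>2 = (\<Sum>i\<in>UNIV. d i * (cmod ((conj_transpose U *v x) $ i))\<^sup>2)" for x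
  proof -
    let ?D = "diag_matrix (\<lambda>i. complex_of_real (d i))"
    have "complex_of_real ((norm (M *v x))\<^sup>2) = cinner x ((conj_transpose M ** M) *v x)"
      by (metis cinner_self cinner_matrix_left matrix_vector_mul_assoc)
    also have "\<dots> = cinner x (U *v (?D *v (conj_transpose U *v x)))"
      unfolding d by (simp add: matrix_vector_mul_assoc matrix_mul_assoc)
    also have "\<dots> = cinner (conj_transpose U *v x) (?D *v (conj_transpose U *v x))"
      by (rule cinner_matrix_right)
    finally show ?thesis unfolding cinner_diag_matrix of_real_eq_iff .
  qed
  moreover have "proots (charpoly (conj_transpose M ** M)) = (\<Sum>i\<in>UNIV. {#complex_of_real (d i)#})"
    by (simp add: charpoly_diagonalized[OF U d] proots_prod)
  then have "proots (charpoly (conj_transpose M ** M)) = image_mset (\<lambda>i. complex_of_real (d i)) (mset_set UNIV)"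
    by (simp add: sum_unfold_sum_mset)
  then have "mset (singular_values M) = image_mset (\<lambda>i. sqrt (d i)) (mset_set UNIV)"
    by (simp add: singular_values_def image_mset.compositionality comp_def)
  ultimately show ?thesis using U that by blast
qed

lemma singular_value_nonneg: "singular_value k M \<ge> 0"
proof -
  obtain U d where U: "unitary U"
    and d: "\<forall>x. (norm (M *v x))\<^sup>2 = (\<Sum>i\<in>UNIV. d i * (cmod ((conj_transpose U *v x) $ i))\<^sup>2)"
    and mset: "mset (singular_values M) = image_mset (\<lambda>i. sqrt (d i)) (mset_set UNIV)"
    by (rule singular_value_decomposition[of M])
  have "0 \<le> d i" for i
  proof -
    have "conj_transpose U *v (U *v axis i 1) = axis i 1"
      using U by (simp add: matrix_vector_mul_assoc unitary_def)
    then have "(norm (M *v (U *v axis i 1)))\<^sup>2 = (\<Sum>j\<in>UNIV. d j * (cmod (axis i 1 $ j))\<^sup>2)"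
      by (simp only: d)
    also have "\<dots> = (\<Sum>j\<in>UNIV. if j = i then d i else 0)"
      by (intro sum.cong) (auto simp: axis_def)
    finally have "d i = (norm (M *v (U *v axis i 1)))\<^sup>2" by simp
    then show ?thesis by simp
  qed
  moreover have "set (singular_values M) = range (\<lambda>i. sqrt (d i))"
    using arg_cong[OF mset, of set_mset] by simp
  ultimately have "t \<ge> 0" if "t \<in> set (singular_values M)" for t
    using that by auto
  then show ?thesis by (auto simp: singular_value_def)
qed

text \<open>One half of the min-max principle: \<open>F\<close> consists of the right singular
  vectors whose singular value is below the \<open>k\<close>-th. Positivity excludes the default
  value 0 for \<open>k\<close> beyond the dimension, where the bound on \<open>card F\<close> would
  fail.\<close>

lemma singular_value_large_on_complement:
  fixes M :: "complex ^ 'n ^ 'n"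
  assumes pos: "singular_value k M > 0"
  obtains F where "finite F" "card F + k \<le> CARD('n)"
    "\<And>x. (\<And>a. a \<in> F \<Longrightarrow> cinner a x = 0) \<Longrightarrow> singular_value k M * norm x \<le> norm (M *v x)"
proof -
  obtain U d where U: "unitary U"
    and d: "\<forall>x. (norm (M *v x))\<^sup>2 = (\<Sum>i\<in>UNIV. d i * (cmod ((conj_transpose U *v x) $ i))\<^sup>2)"
    and mset: "mset (singular_values M) = image_mset (\<lambda>i. sqrt (d i)) (mset_set UNIV)"
    by (rule singular_value_decomposition[of M])
  have sorted: "sorted (rev (singular_values M))"
    by (simp add: singular_values_def)
  define \<sigma> where "\<sigma> = singular_value k M"
  have \<sigma>: "\<sigma> > 0" using pos by (simp add: \<sigma>_def)
  let ?L = "singular_values M"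
  have k: "1 \<le> k" "k \<le> length ?L" "\<sigma> = ?L ! (k - 1)"
    using pos by (auto simp: \<sigma>_def singular_value_def split: if_splits)
  define T where "T = {i. \<sigma> \<le> sqrt (d i)}"
  have "k \<le> length (filter (\<lambda>t. \<sigma> \<le> t) ?L)"
  proof -
    have "\<sigma> \<le> t" if t: "t \<in> set (take k ?L)" for t
    proof -
      obtain j where j: "j < k" "t = ?L ! j"
        using t k by (auto simp: in_set_conv_nth)
      have "sorted_wrt (\<ge>) ?L" using sorted by (simp add: sorted_wrt_rev)
      then show ?thesis
        using j k by (cases "j = k - 1") (auto simp: sorted_wrt_iff_nth_less)
    qed
    then have "filter (\<lambda>t. \<sigma> \<le> t) (take k ?L) = take k ?L" by simp
    then have "k = length (filter (\<lambda>t. \<sigma> \<le> t) (take k ?L))" using k by simp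
    also have "\<dots> \<le> length (filter (\<lambda>t. \<sigma> \<le> t) (take k ?L @ drop k ?L))"
      unfolding filter_append length_append by simp
    finally show ?thesis by simp
  qed
  \<comment> \<open>The count passes from the ordered list to the index set through the multiset,
    which forgets the order.\<close>
  also have "\<dots> = size (filter_mset (\<lambda>t. \<sigma> \<le> t) (mset ?L))"
    by (metis mset_filter size_mset)
  also have "\<dots> = card T"
    by (simp add: mset filter_mset_image_mset T_def)
  finally have kT: "k \<le> card T" .
  show ?thesis
  proof (rule that)
    let ?F = "(\<lambda>i. column i U) ` (- T)"
    show "finite ?F" by simp
    have "card ?F \<le> card (- T)" by (rule card_image_le) simp
    also have "\<dots> = CARD('n) - card T" by (simp add: Compl_eq_Diff_UNIV card_Diff_subset)
    finally show "card ?F + k \<le> CARD('n)" using kT card_mono[of UNIV T] by simp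
    fix x assume x: "\<And>a. a \<in> ?F \<Longrightarrow> cinner a x = 0"
    define y where "y = conj_transpose U *v x"
    have y0: "y $ i = 0" if "i \<notin> T" for i
      using x[of "column i U"] that by (simp add: cinner_column y_def)
    have ny: "norm y = norm x" unfolding y_def using U by (intro unitary_norm unitary_conj_transpose)
    have "(norm (M *v x))\<^sup>2 = (\<Sum>i\<in>UNIV. d i * (cmod (y $ i))\<^sup>2)"
      unfolding y_def using d by blast
    moreover have "\<dots> \<ge> (\<Sum>i\<in>UNIV. \<sigma>\<^sup>2 * (cmod (y $ i))\<^sup>2)"
    proof (rule sum_mono)
      fix i
      show "\<sigma>\<^sup>2 * (cmod (y $ i))\<^sup>2 \<le> d i * (cmod (y $ i))\<^sup>2"
      proof (cases "i \<in> T")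
        case True
        then have "\<sigma> \<le> sqrt (d i)" by (simp add: T_def)
        then have "0 < sqrt (d i)" "\<sigma>\<^sup>2 \<le> (sqrt (d i))\<^sup>2"
          using \<sigma> by (auto intro: power_mono simp del: real_sqrt_gt_0_iff)
        then have "\<sigma>\<^sup>2 \<le> d i" by simp
        then show ?thesis by (intro mult_right_mono) auto
      qed (simp add: y0)
    qed
    moreover have "(\<Sum>i\<in>UNIV. \<sigma>\<^sup>2 * (cmod (y $ i))\<^sup>2) = (\<sigma> * norm x)\<^sup>2"
      by (simp add: power_mult_distrib norm_vec_cmod flip: ny sum_distrib_left)
    ultimately have "(\<sigma> * norm x)\<^sup>2 \<le> (norm (M *v x))\<^sup>2" by simp
    then show "singular_value k M * norm x \<le> norm (M *v x)"
      unfolding \<sigma>_def[symmetric] by (rule power2_le_imp_le) simp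
  qed
qed

lemma singular_value_pos_le_card:
  fixes M :: "complex ^ 'n ^ 'n"
  assumes "singular_value k M > 0"
  shows "k \<le> CARD('n)"
  by (rule singular_value_large_on_complement[OF assms]) simp

section \<open>Hermitian parts in varying directions\<close>

definition hermitian_part :: "complex \<Rightarrow> complex ^ 'n ^ 'n \<Rightarrow> complex ^ 'n ^ 'n"
  where "hermitian_part w M = (\<chi> i j. (cnj w * M $ i $ j + w * cnj (M $ j $ i)) / 2)"

lemma conj_transpose_hermitian_part [simp]:
  "conj_transpose (hermitian_part w M) = hermitian_part w M"
  by (simp add: conj_transpose_def hermitian_part_def vec_eq_iff add.commute)

lemma hermitian_part_vec:
  "hermitian_part w M *v x = (1 / 2) *s (cnj w *s (M *v x) + w *s (conj_transpose M *v x))"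
  by (simp add: hermitian_part_def conj_transpose_def matrix_vector_mult_def vec_eq_iff
      sum_distrib_left add_divide_distrib ring_distribs sum.distrib sum_divide_distrib mult_ac)

text \<open>The form of \<open>hermitian_part w M\<close> is the real inner product of
  \<open>w\<close> and \<open>cinner x (M *v x)\<close> as plane vectors, hence the exponent of a
  plane character with frequency \<open>w\<close>.\<close>

lemma cinner_hermitian_part:
  "cinner x (hermitian_part w M *v x) = complex_of_real (Re (cnj w * cinner x (M *v x)))"
proof -
  have "cinner x (conj_transpose M *v x) = cnj (cinner x (M *v x))"
    by (metis cinner_commute cinner_matrix_left)
  then have "cinner x (hermitian_part w M *v x)
      = (cnj w * cinner x (M *v x) + cnj (cnj w * cinner x (M *v x))) / 2"
    by (simp add: hermitian_part_vec cinner_scale_right cinner_add_right)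
  then show ?thesis by (simp only: complex_add_cnj) simp
qed

text \<open>One eigenbasis serves a whole line through the origin, so decompositions are chosen on
  the unit circle only.\<close>

lemma hermitian_part_scale:
  assumes "hermitian_part w M = U ** diag_matrix (\<lambda>i. complex_of_real (d i)) ** conj_transpose U"
  shows "hermitian_part (complex_of_real t * w) M
    = U ** diag_matrix (\<lambda>i. complex_of_real (t * d i)) ** conj_transpose U"
proof -
  have "hermitian_part (complex_of_real t * w) M *v x
      = (U ** diag_matrix (\<lambda>i. complex_of_real (t * d i)) ** conj_transpose U) *v x" for x
  proof -
    have "hermitian_part (complex_of_real t * w) M *v x = complex_of_real t *s (hermitian_part w M *v x)"
      by (simp add: hermitian_part_vec vec_eq_iff algebra_simps)
    also have "\<dots> = complex_of_real t *s (U *v (diag_matrix (\<lambda>i. complex_of_real (d i)) *v (conj_transpose U *v x)))"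
      by (simp add: assms matrix_vector_mul_assoc matrix_mul_assoc)
    also have "\<dots> = U *v (complex_of_real t *s (diag_matrix (\<lambda>i. complex_of_real (d i)) *v (conj_transpose U *v x)))"
      by (simp add: vec.scale)
    also have "complex_of_real t *s (diag_matrix (\<lambda>i. complex_of_real (d i)) *v z)
        = diag_matrix (\<lambda>i. complex_of_real (t * d i)) *v z" for z
      by (simp add: diag_matrix_mult_vec vec_eq_iff)
    finally show ?thesis by (simp add: matrix_vector_mul_assoc matrix_mul_assoc)
  qed
  then show ?thesis by (simp add: matrix_eq)
qed

text \<open>Two hermitian parts of \<open>M\<close> in different directions recover \<open>M\<close>; each is small off at most
  four eigenvectors, while \<open>M\<close> is large off \<open>n - 9\<close> vectors.\<close>

lemma singular_value_le_hermitian_parts: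
  fixes M :: "complex ^ 'n ^ 'n"
  assumes pos: "singular_value 9 M > 0"
    and w: "cmod w = 1" "cmod w' = 1" and s: "s \<ge> 0" "s' \<ge> 0"
    and U: "unitary U" "hermitian_part w M = U ** diag_matrix (\<lambda>i. complex_of_real (d i)) ** conj_transpose U"
    and U': "unitary U'" "hermitian_part w' M = U' ** diag_matrix (\<lambda>i. complex_of_real (d' i)) ** conj_transpose U'"
    and d: "card {i. s < \<bar>d i\<bar>} < 5" "card {i. s' < \<bar>d' i\<bar>} < 5"
  shows "singular_value 9 M * \<bar>Im (w' * cnj w)\<bar> \<le> s + s'"
proof -
  define \<sigma> where "\<sigma> = singular_value 9 M"
  obtain F where F: "finite F" "card F + 9 \<le> CARD('n)"
    "\<And>x. (\<And>a. a \<in> F \<Longrightarrow> cinner a x = 0) \<Longrightarrow> \<sigma> * norm x \<le> norm (M *v x)"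
    unfolding \<sigma>_def using singular_value_large_on_complement[OF pos] by blast
  let ?G = "(\<lambda>i. column i U) ` {i. s < \<bar>d i\<bar>}" and ?G' = "(\<lambda>i. column i U') ` {i. s' < \<bar>d' i\<bar>}"
  have "card ?G \<le> 4" "card ?G' \<le> 4"
    using d card_image_le[of "{i. s < \<bar>d i\<bar>}" "\<lambda>i. column i U"]
      card_image_le[of "{i. s' < \<bar>d' i\<bar>}" "\<lambda>i. column i U'"] by auto
  \<comment> \<open>There are at most (n - 9) + 4 + 4 = n - 1 conditions, so a nonzero vector
    satisfies them all: the index 9 is 4 + 4 + 1.\<close>
  then have "card (F \<union> (?G \<union> ?G')) < CARD('n)"
    using F(2) card_Un_le[of F "?G \<union> ?G'"] card_Un_le[of ?G ?G'] by linarith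
  then obtain x where x: "x \<noteq> 0" "\<forall>a \<in> F \<union> (?G \<union> ?G'). cinner a x = 0"
    using ex_orthogonal[of "F \<union> (?G \<union> ?G')"] F(1) by auto
  have large: "\<sigma> * norm x \<le> norm (M *v x)"
    using x F by blast
  have small: "norm (hermitian_part w M *v x) \<le> s * norm x"
    using x by (intro hermitian_small_on_complement[OF U _ s(1)]) auto
  have small': "norm (hermitian_part w' M *v x) \<le> s' * norm x"
    using x by (intro hermitian_small_on_complement[OF U' _ s(2)]) auto
  \<comment> \<open>The terms with \<open>conj_transpose M\<close> carry the same factor
    \<open>w * w'\<close> and cancel; what remains is \<open>M\<close> times the sine of the angle,
    up to the factor \<i>.\<close>
  have "w' *s (hermitian_part w M *v x) - w *s (hermitian_part w' M *v x)
      = (\<i> * complex_of_real (Im (w' * cnj w))) *s (M *v x)"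
  proof -
    have c: "\<i> * complex_of_real (Im (w' * cnj w)) = (w' * cnj w - w * cnj w') / 2"
      by (simp add: complex_eq_iff)
    show ?thesis unfolding c
      by (simp add: hermitian_part_vec vec_eq_iff field_simps)
  qed
  then have "\<bar>Im (w' * cnj w)\<bar> * norm (M *v x)
      = norm (w' *s (hermitian_part w M *v x) - w *s (hermitian_part w' M *v x))"
    by (simp only: norm_scale norm_mult norm_ii norm_of_real mult_1 real_norm_def)
  also have "\<dots> \<le> norm (hermitian_part w M *v x) + norm (hermitian_part w' M *v x)"
    using norm_triangle_ineq4[of "w' *s (hermitian_part w M *v x)" "w *s (hermitian_part w' M *v x)"] w
    by (simp add: norm_scale)
  finally have "\<bar>Im (w' * cnj w)\<bar> * norm (M *v x) \<le> (s + s') * norm x"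
    using small small' by (simp add: algebra_simps)
  moreover have "\<bar>Im (w' * cnj w)\<bar> * (\<sigma> * norm x) \<le> \<bar>Im (w' * cnj w)\<bar> * norm (M *v x)"
    using large by (intro mult_left_mono) auto
  ultimately have "\<sigma> * \<bar>Im (w' * cnj w)\<bar> * norm x \<le> (s + s') * norm x"
    by (simp add: mult_ac)
  then show ?thesis using x(1) by (simp add: \<sigma>_def)
qed

text \<open>If \<open>u\<close> minimized \<open>s\<close>, the hypothesis at \<open>u\<close> and
  \<open>w\<close> would give the bound at once. As \<open>s\<close> need not be continuous, the
  minimum may not be attained; instead \<open>u\<close> is a limit point of a minimizing sequence,
  and only the left-hand side has to be continuous.\<close>

lemma ex_exceptional_direction:
  fixes s :: "complex \<Rightarrow> real" and c :: real
  assumes s0: "\<And>w. cmod w = 1 \<Longrightarrow> 0 \<le> s w"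
    and s: "\<And>w w'. cmod w = 1 \<Longrightarrow> cmod w' = 1 \<Longrightarrow> c * \<bar>Im (w' * cnj w)\<bar> \<le> s w + s w'"
  obtains u where "cmod u = 1" "\<And>w. cmod w = 1 \<Longrightarrow> c / 2 * \<bar>Im (w * cnj u)\<bar> \<le> s w"
proof -
  define m where "m = Inf (s ` sphere 0 1)"
  have bdd: "bdd_below (s ` sphere 0 1)" using s0 by (intro bdd_belowI[of _ 0]) auto
  have ne: "s ` sphere 0 1 \<noteq> {}" by simp
  have m: "m \<le> s w" if "cmod w = 1" for w
    unfolding m_def using that bdd by (intro cInf_lower) auto
  have "\<exists>v. cmod v = 1 \<and> s v < m + 1 / real (Suc k)" for k
    using cInf_lessD[OF ne, of "m + 1 / real (Suc k)"] by (auto simp: m_def)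
  then obtain v where v: "\<And>k. cmod (v k) = 1" "\<And>k. s (v k) < m + 1 / real (Suc k)" by metis
  obtain u r where u: "u \<in> sphere 0 1" "strict_mono r" "(v \<circ> r) \<longlonglongrightarrow> u"
    using v(1) seq_compactE[of "sphere (0 :: complex) 1" v] compact_imp_seq_compact[of "sphere (0 :: complex) 1"]
    by auto
  show ?thesis
  proof (rule that)
    show "cmod u = 1" using u by simp
    fix w :: complex assume w: "cmod w = 1"
    have "c * \<bar>Im (w * cnj u)\<bar> \<le> 2 * s w + 0"
    proof (rule LIMSEQ_le)
      show "(\<lambda>k. c * \<bar>Im (w * cnj ((v \<circ> r) k))\<bar>) \<longlonglongrightarrow> c * \<bar>Im (w * cnj u)\<bar>"
        by (intro tendsto_intros u)
      show "(\<lambda>k. 2 * s w + 1 / real (Suc (r k))) \<longlonglongrightarrow> 2 * s w + 0"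
        using LIMSEQ_subseq_LIMSEQ[OF lim_inverse_n' [THEN LIMSEQ_Suc] u(2)]
        by (intro tendsto_intros) (simp add: comp_def)
      have "c * \<bar>Im (w * cnj ((v \<circ> r) k))\<bar> \<le> 2 * s w + 1 / real (Suc (r k))" for k
        using s[of "v (r k)" w] v[of "r k"] m[OF w] w by simp
      then show "\<exists>N. \<forall>n\<ge>N. c * \<bar>Im (w * cnj ((v \<circ> r) n))\<bar> \<le> 2 * s w + 1 / real (Suc (r n))"
        by blast
    qed
    then show "c / 2 * \<bar>Im (w * cnj u)\<bar> \<le> s w" by simp
  qed
qed

text \<open>The form of the hermitian part is bounded by the largest eigenvalue modulus. Comparing
  two antipodal points of the disk in the direction of \<open>w\<close> eliminates the unknown
  centre.\<close>

lemma numerical_range_ball_eigenvalue: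
  fixes M :: "complex ^ 'n ^ 'n"
  assumes ball: "ball c r \<subseteq> numerical_range M" and r: "0 < r"
    and U: "unitary U" "hermitian_part w M = U ** diag_matrix (\<lambda>i. complex_of_real (d i)) ** conj_transpose U"
  obtains i where "r * cmod w \<le> \<bar>d i\<bar>"
proof -
  define s where "s = Max (range (\<lambda>i. \<bar>d i\<bar>))"
  have le: "\<bar>d i\<bar> \<le> s" for i by (simp add: s_def)
  have "s \<in> range (\<lambda>i. \<bar>d i\<bar>)" unfolding s_def by (rule Max_in) auto
  then obtain i where i: "s = \<bar>d i\<bar>" by auto
  have bound: "\<bar>Re (cnj w * z)\<bar> \<le> s" if z: "z \<in> ball c r" for z
  proof -
    obtain x where x: "z = cinner x (M *v x)" "norm x = 1"
      using z ball by (auto simp: numerical_range_def)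
    have "cmod (cinner x (hermitian_part w M *v x)) \<le> s * (norm x)\<^sup>2"
      using i le by (intro hermitian_quadratic_le[OF U]) auto
    then show ?thesis unfolding cinner_hermitian_part norm_of_real using x by simp
  qed
  have "r * cmod w \<le> s"
  \<comment> \<open>The ball is open, so its boundary is only approached, at the fraction
    \<open>t\<close> of the radius.\<close>
  proof (rule field_le_mult_one_interval)
    fix t :: real assume t: "0 < t" "t < 1"
    define h where "h = complex_of_real (t * r) * sgn w"
    have "cmod h < r" using t r by (auto simp: h_def norm_mult norm_sgn)
    then have "c + h \<in> ball c r" "c - h \<in> ball c r" by (simp_all add: dist_norm)
    from bound[OF this(1)] bound[OF this(2)] have "2 * \<bar>Re (cnj w * h)\<bar> \<le> 2 * s"
      by (simp add: algebra_simps)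
    moreover have "cnj w * w = complex_of_real ((cmod w)\<^sup>2)"
      by (simp add: complex_norm_square mult.commute del: of_real_power)
    then have "cnj w * sgn w = complex_of_real (cmod w)"
      by (simp add: sgn_eq power2_eq_square)
    then have "cnj w * h = complex_of_real (t * r * cmod w)"
      by (simp add: h_def mult_ac)
    then have "Re (cnj w * h) = t * r * cmod w" by (simp only: Re_complex_of_real)
    ultimately have "\<bar>t * r * cmod w\<bar> \<le> s" by (simp only:)
    then show "t * (r * cmod w) \<le> s" by (simp add: mult.assoc)
  qed
  then show ?thesis using that i by simp
qed

text \<open>Coordinates adapted to the exceptional direction \<open>u\<close>: the component of the
  frequency across \<open>u\<close> is \<open>b\<close>, which controls five eigenvalues, while the
  disk controls one through the full modulus, which is at least the modulus of
  \<open>a\<close>.\<close>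

lemma hermitian_part_eigenvalues:
  fixes M :: "complex ^ 'n ^ 'n"
  assumes pos: "singular_value 9 M > 0"
    and ball: "ball c r \<subseteq> numerical_range M" and r: "0 < r"
  obtains u where "cmod u = 1"
    "\<And>a b. \<exists>U d. unitary U
      \<and> hermitian_part (u * Complex a b) M = U ** diag_matrix (\<lambda>i. complex_of_real (d i)) ** conj_transpose U
      \<and> 5 \<le> card {i. singular_value 9 M / 2 * \<bar>b\<bar> \<le> \<bar>d i\<bar>} \<and> (\<exists>i. r * \<bar>a\<bar> \<le> \<bar>d i\<bar>)"
proof -
  define \<sigma> where "\<sigma> = singular_value 9 M"
  have n: "5 \<le> CARD('n)" using singular_value_pos_le_card[OF pos] by simp
  \<comment> \<open>The fifth largest eigenvalue modulus \<open>s\<close> is chosen for all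
    directions at once, since the exceptional direction is extracted from it as a function of
    \<open>w\<close>.\<close>
  have "\<exists>U d s. unitary U \<and> hermitian_part w M = U ** diag_matrix (\<lambda>i. complex_of_real (d i)) ** conj_transpose U
      \<and> 0 \<le> s \<and> 5 \<le> card {i. s \<le> \<bar>d i\<bar>} \<and> card {i. s < \<bar>d i\<bar>} < 5" for w
  proof -
    obtain U d where "unitary U" "hermitian_part w M = U ** diag_matrix (\<lambda>i. complex_of_real (d i)) ** conj_transpose U"
      by (rule hermitian_spectral[OF conj_transpose_hermitian_part])
    moreover obtain s where "s \<in> range (\<lambda>i. \<bar>d i\<bar>)" "5 \<le> card {i. s \<le> \<bar>d i\<bar>}" "card {i. s < \<bar>d i\<bar>} < 5"
      using ex_kth_largest[of 5 "\<lambda>i. \<bar>d i\<bar>"] n by auto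
    moreover have "0 \<le> s" using \<open>s \<in> _\<close> by auto
    ultimately show ?thesis by blast
  qed
  then obtain U d s where *: "\<And>w. unitary (U w)"
    "\<And>w. hermitian_part w M = U w ** diag_matrix (\<lambda>i. complex_of_real (d w i)) ** conj_transpose (U w)"
    "\<And>w. 0 \<le> s w" "\<And>w. 5 \<le> card {i. s w \<le> \<bar>d w i\<bar>}" "\<And>w. card {i. s w < \<bar>d w i\<bar>} < 5"
    by metis
  obtain u where u: "cmod u = 1" "\<And>w. cmod w = 1 \<Longrightarrow> \<sigma> / 2 * \<bar>Im (w * cnj u)\<bar> \<le> s w"
  proof (rule ex_exceptional_direction[of s \<sigma>])
    fix w w' :: complex assume w: "cmod w = 1" "cmod w' = 1"
    show "\<sigma> * \<bar>Im (w' * cnj w)\<bar> \<le> s w + s w'"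
      unfolding \<sigma>_def
      by (rule singular_value_le_hermitian_parts[OF pos w *(3) *(3) *(1) *(2) *(1) *(2) *(5) *(5)])
  qed (use * in auto)
  show ?thesis
  proof (rule that[OF u(1)])
    fix a b :: real
    define w where "w = u * Complex a b"
    \<comment> \<open>For \<open>w = 0\<close> any unit direction will do, as its eigenvalues are
      scaled by 0.\<close>
    define e where "e = (if w = 0 then 1 else sgn w)"
    have e: "cmod e = 1" "w = complex_of_real (cmod w) * e"
      by (simp add: e_def norm_sgn, simp add: e_def sgn_eq)
    have dec: "hermitian_part w M
        = U e ** diag_matrix (\<lambda>i. complex_of_real (cmod w * d e i)) ** conj_transpose (U e)"
      using hermitian_part_scale[OF *(2)[of e], of "cmod w"] e(2) by simp
    obtain i where i: "r * cmod w \<le> \<bar>cmod w * d e i\<bar>"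
      using numerical_range_ball_eigenvalue[OF ball r *(1) dec] by auto
    have "w * cnj u = Complex a b"
      using u(1) by (simp add: w_def mult_ac complex_norm_square[symmetric])
    then have "b = Im (complex_of_real (cmod w) * (e * cnj u))"
      using e(2) by (metis complex.sel(2) mult.assoc)
    then have "\<bar>b\<bar> = cmod w * \<bar>Im (e * cnj u)\<bar>"
      by (simp add: abs_mult)
    then have "\<sigma> / 2 * \<bar>b\<bar> \<le> cmod w * s e"
      using mult_left_mono[OF u(2)[OF e(1)], of "cmod w"] by (simp add: mult_ac)
    then have "{i. s e \<le> \<bar>d e i\<bar>} \<subseteq> {i. \<sigma> / 2 * \<bar>b\<bar> \<le> \<bar>cmod w * d e i\<bar>}"
      using mult_left_mono[of "s e" _ "cmod w"] by (fastforce simp: abs_mult)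
    then have "5 \<le> card {i. \<sigma> / 2 * \<bar>b\<bar> \<le> \<bar>cmod w * d e i\<bar>}"
      using *(4)[of e] card_mono[OF finite] by (meson order_trans)
    moreover have "\<bar>a\<bar> \<le> cmod w"
      using abs_Re_le_cmod[of "Complex a b"] u(1) by (simp add: w_def norm_mult)
    then have "r * \<bar>a\<bar> \<le> \<bar>cmod w * d e i\<bar>"
      using i r mult_left_mono[of "\<bar>a\<bar>" "cmod w" r] by linarith
    then have "\<exists>i. r * \<bar>a\<bar> \<le> \<bar>cmod w * d e i\<bar>" ..
    ultimately have "unitary (U e)
      \<and> hermitian_part w M = U e ** diag_matrix (\<lambda>i. complex_of_real (cmod w * d e i)) ** conj_transpose (U e)
      \<and> 5 \<le> card {i. \<sigma> / 2 * \<bar>b\<bar> \<le> \<bar>cmod w * d e i\<bar>} \<and> (\<exists>i. r * \<bar>a\<bar> \<le> \<bar>cmod w * d e i\<bar>)"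
      using *(1)[of e] dec by blast
    then show "\<exists>U d. unitary U
      \<and> hermitian_part (u * Complex a b) M = U ** diag_matrix (\<lambda>i. complex_of_real (d i)) ** conj_transpose U
      \<and> 5 \<le> card {i. singular_value 9 M / 2 * \<bar>b\<bar> \<le> \<bar>d i\<bar>} \<and> (\<exists>i. r * \<bar>a\<bar> \<le> \<bar>d i\<bar>)"
      unfolding w_def[symmetric] \<sigma>_def[symmetric] by - (rule exI, rule exI[of _ "\<lambda>i. cmod w * d e i"])
  qed
qed

section \<open>Uniqueness of the Haar measure on the sphere\<close>

lemma nn_integral_lborel_translate:
  fixes g :: "'a :: euclidean_space \<Rightarrow> ennreal"
  assumes [measurable]: "g \<in> borel_measurable borel"
  shows "(\<integral>\<^sup>+x. g (c + x) \<partial>lborel) = (\<integral>\<^sup>+x. g x \<partial>lborel)"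
proof -
  have "(\<integral>\<^sup>+x. g x \<partial>lborel) = (\<integral>\<^sup>+x. g x \<partial>distr lborel borel ((+) c))"
    by (simp add: lborel_distr_plus)
  also have "\<dots> = (\<integral>\<^sup>+x. g (c + x) \<partial>lborel)"
    by (rule nn_integral_distr) simp_all
  finally show ?thesis by simp
qed

lemma nn_integral_lborel_isometry:
  fixes f :: "'a :: euclidean_space \<Rightarrow> 'a" and g :: "'a \<Rightarrow> ennreal"
  assumes f: "linear f" "\<And>x. norm (f x) = norm x"
    and g [measurable]: "g \<in> borel_measurable borel"
  shows "(\<integral>\<^sup>+x. g (f x) \<partial>lborel) = (\<integral>\<^sup>+x. g x \<partial>lborel)"
proof -
  have [measurable]: "f \<in> borel_measurable borel"
    using f(1) by (intro borel_measurable_continuous_onI linear_continuous_on linear_linear[THEN iffD2])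
  have "inj f"
    using f by (metis linear_injective_0 norm_eq_zero)
  then have surj: "surj f" using f(1) by (simp add: linear_injective_imp_surjective)
  define B where "B = ball (0 :: 'a) 1"
  have [measurable]: "B \<in> sets borel" by (simp add: B_def)
  have b: "emeasure lborel B \<noteq> 0" "emeasure lborel B \<noteq> \<infinity>"
    using emeasure_lborel_ball_finite[of "0 :: 'a" 1] content_ball_pos[of 1 "0 :: 'a"]
    by (auto simp: B_def measure_def)
  text \<open>Two translation-invariant integrals are compared by Fubini against the symmetric set \<open>B\<close>.\<close>
  have "emeasure lborel B * (\<integral>\<^sup>+y. g (f y) \<partial>lborel)
      = (\<integral>\<^sup>+x. indicator B x * (\<integral>\<^sup>+y. g (f y) \<partial>lborel) \<partial>lborel)"
    by (simp add: nn_integral_multc)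
  also have "\<dots> = (\<integral>\<^sup>+x. (\<integral>\<^sup>+y. indicator B x * g (f y + x) \<partial>lborel) \<partial>lborel)"
  proof (rule nn_integral_cong)
    fix x
    obtain z where z: "f z = x" using surj by (metis surjD)
    have "(\<integral>\<^sup>+y. g (f y) \<partial>lborel) = (\<integral>\<^sup>+y. g (f (z + y)) \<partial>lborel)"
      by (rule nn_integral_lborel_translate[symmetric]) simp
    also have "\<dots> = (\<integral>\<^sup>+y. g (f y + x) \<partial>lborel)"
      by (simp add: linear_add[OF f(1)] z add.commute)
    finally show "indicator B x * (\<integral>\<^sup>+y. g (f y) \<partial>lborel) = (\<integral>\<^sup>+y. indicator B x * g (f y + x) \<partial>lborel)"
      by (simp add: nn_integral_cmult)
  qed
  also have "\<dots> = (\<integral>\<^sup>+y. (\<integral>\<^sup>+x. indicator B x * g (f y + x) \<partial>lborel) \<partial>lborel)"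
    by (rule lborel_pair.Fubini') simp
  also have "\<dots> = (\<integral>\<^sup>+y. (\<integral>\<^sup>+x. indicator B (x - f y) * g x \<partial>lborel) \<partial>lborel)"
  proof (rule nn_integral_cong)
    fix y
    show "(\<integral>\<^sup>+x. indicator B x * g (f y + x) \<partial>lborel) = (\<integral>\<^sup>+x. indicator B (x - f y) * g x \<partial>lborel)"
      using nn_integral_lborel_translate[of "\<lambda>x. indicator B (x - f y) * g x" "f y"] by simp
  qed
  also have "\<dots> = (\<integral>\<^sup>+x. (\<integral>\<^sup>+y. indicator B (x - f y) * g x \<partial>lborel) \<partial>lborel)"
    by (rule lborel_pair.Fubini') simp
  also have "\<dots> = (\<integral>\<^sup>+x. emeasure lborel B * g x \<partial>lborel)"
  proof (rule nn_integral_cong)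
    fix x
    obtain z where z: "f z = x" using surj by (metis surjD)
    have "(\<integral>\<^sup>+y. indicator B (x - f y) * g x \<partial>lborel) = (\<integral>\<^sup>+y. indicator B (x - f (z + y)) * g x \<partial>lborel)"
      by (rule nn_integral_lborel_translate[symmetric]) simp
    \<comment> \<open>Here \<open>x - f (z + y)\<close> is \<open>- f y\<close>, and the centred
      ball \<open>B\<close> is preserved by \<open>f\<close> and by reflection.\<close>
    also have "\<dots> = (\<integral>\<^sup>+y. indicator B y * g x \<partial>lborel)"
      by (simp add: linear_add[OF f(1)] z B_def indicator_def f(2))
    finally show "(\<integral>\<^sup>+y. indicator B (x - f y) * g x \<partial>lborel) = emeasure lborel B * g x"
      by (simp add: nn_integral_multc)
  qed
  also have "\<dots> = emeasure lborel B * (\<integral>\<^sup>+x. g x \<partial>lborel)"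
    by (simp add: nn_integral_cmult)
  finally show ?thesis
    using b by (simp add: ennreal_mult_cancel_left)
qed

lemma linear_matrix_vector: "linear ((*v) (A :: complex ^ 'n ^ 'm))"
  by (rule linearI) (simp_all add: vec.add scaleR_eq_scale vec.scale)

lemma borel_measurable_matrix_vector [measurable]:
  "(*v) (A :: complex ^ 'n ^ 'm) \<in> borel_measurable borel"
  by (intro borel_measurable_continuous_onI linear_continuous_on linear_linear[THEN iffD2]
      linear_matrix_vector)

section \<open>Comparison of invariant measures through the masses of balls\<close>

lemma haar_sphere_ball:
  fixes \<mu> :: "(complex ^ 'n) measure"
  assumes "haar_sphere \<mu>" "norm x = 1" "norm y = 1"
  shows "emeasure \<mu> (ball x h) = emeasure \<mu> (ball y h)"
proof -
  obtain U where U: "unitary U" "U *v x = y" using unitary_transitive[OF assms(2,3)] .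
  have [measurable_cong]: "sets \<mu> = sets borel" using assms(1) by (simp add: haar_sphere_def)
  then have [simp]: "space \<mu> = UNIV" by (metis sets_eq_imp_space_eq space_borel)
  have "dist (U *v x) (U *v z) = dist x z" for z
    using unitary_norm[OF U(1), of "x - z"] by (simp add: dist_norm vec.diff)
  then have "(*v) U -` ball y h = ball x h"
    using U(2) by auto
  moreover have "emeasure \<mu> (ball y h) = emeasure (distr \<mu> borel ((*v) U)) (ball y h)"
    using assms(1) U(1) by (simp add: haar_sphere_def)
  ultimately show ?thesis
    by (simp add: emeasure_distr)
qed

text \<open>Finitely many balls of radius \<open>h\<close> cover the compact sphere and all have the
  same mass; were it 0, the sphere would be null.\<close>

lemma haar_sphere_ball_pos:
  fixes \<mu> :: "(complex ^ 'n) measure"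
  assumes "haar_sphere \<mu>" "norm x = 1" "h > 0"
  shows "emeasure \<mu> (ball x h) \<noteq> 0"
proof
  assume 0: "emeasure \<mu> (ball x h) = 0"
  have sets: "sets \<mu> = sets borel" using assms(1) by (simp add: haar_sphere_def)
  then have [simp]: "space \<mu> = UNIV" by (metis sets_eq_imp_space_eq space_borel)
  interpret prob_space \<mu> using assms(1) by (simp add: haar_sphere_def)
  have compact: "compact (sphere (0 :: complex ^ 'n) 1)" by simp
  have "sphere (0 :: complex ^ 'n) 1 \<subseteq> (\<Union>y\<in>sphere 0 1. ball y h)" using \<open>h > 0\<close> by force
  then obtain C where C: "C \<subseteq> sphere (0 :: complex ^ 'n) 1" "finite C" "sphere 0 1 \<subseteq> (\<Union>y\<in>C. ball y h)"
    by (rule compactE_image[OF compact, where f = "\<lambda>y. ball y h", rotated]) simp_all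
  have "(\<Union>y\<in>C. ball y h) \<in> null_sets \<mu>"
    using C 0 haar_sphere_ball[OF assms(1,2)] by (intro null_sets.finite_UN) (auto simp: sets null_sets_def)
  then have "AE y in \<mu>. y \<notin> (\<Union>y\<in>C. ball y h)" by (rule AE_not_in)
  moreover have "AE y in \<mu>. norm y = 1" using assms(1) by (simp add: haar_sphere_def)
  ultimately have "AE y in \<mu>. False"
    by eventually_elim (use C(3) in auto)
  then show False by simp
qed

text \<open>Christensen's argument for uniformly distributed measures: the mass of the pairs at
  distance below \<open>h\<close> is computed in both orders of integration, and each inner integral
  is the mass of a ball, which does not depend on its centre in the sphere.\<close>

lemma haar_sphere_closed_le:
  fixes \<mu> \<nu> :: "(complex ^ 'n) measure"
  assumes \<mu>: "haar_sphere \<mu>" and \<nu>: "haar_sphere \<nu>" and "closed A"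
  shows "emeasure \<mu> A \<le> emeasure \<nu> A"
proof -
  have [measurable_cong]: "sets \<mu> = sets borel" "sets \<nu> = sets borel"
    using \<mu> \<nu> by (simp_all add: haar_sphere_def)
  then have [simp]: "space \<mu> = UNIV" "space \<nu> = UNIV" by (metis sets_eq_imp_space_eq space_borel)+
  have ball_sets: "ball x h \<in> sets \<mu>" "ball x h \<in> sets \<nu>" for x h
    using \<mu> \<nu> by (simp_all add: haar_sphere_def)
  interpret M: prob_space \<mu> using \<mu> by (simp add: haar_sphere_def)
  interpret N: prob_space \<nu> using \<nu> by (simp add: haar_sphere_def)
  interpret pair_prob_space \<mu> \<nu> ..
  have one: "emeasure \<mu> UNIV = 1" "emeasure \<nu> UNIV = 1"
    using M.emeasure_space_1 N.emeasure_space_1 by simp_all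
  have [measurable]: "A \<in> sets borel" using \<open>closed A\<close> by simp
  have AE: "AE x in \<mu>. norm x = 1" "AE x in \<nu>. norm x = 1"
    using \<mu> \<nu> by (simp_all add: haar_sphere_def)
  define e :: "complex ^ 'n" where "e = axis undefined 1"
  have e: "norm e = 1" by (simp add: e_def norm_eq_sqrt_inner inner_axis_axis)
  define T where "T h = (\<Union>x\<in>A. ball x h)" for h
  have T [measurable]: "T h \<in> sets borel" for h
    unfolding T_def by (intro borel_open open_UN) auto
  have ball: "{y. dist x y < h} = ball x h" for x :: "complex ^ 'n" and h
    by auto
  have le: "emeasure \<mu> A \<le> emeasure \<nu> (T h)" if "h > 0" for h
  proof -
    define c where "c = emeasure \<mu> (ball e h)"
    define d where "d = emeasure \<nu> (ball e h)"
    have c: "AE x in \<mu>. emeasure \<nu> (ball x h) = d" "AE x in \<nu>. emeasure \<mu> (ball x h) = c"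
      using AE haar_sphere_ball[OF \<mu> _ e] haar_sphere_ball[OF \<nu> _ e]
      by (auto simp: c_def d_def elim!: eventually_mono)
    have c0: "c \<noteq> 0" "c \<noteq> \<infinity>"
      using haar_sphere_ball_pos[OF \<mu> e that] by (auto simp: c_def)
    let ?K = "\<lambda>x y. indicator {p. dist (fst p) (snd p) < h} (x, y) :: ennreal"
    have K: "?K x y = indicator {y. dist x y < h} y" "?K x y = indicator {x. dist y x < h} x" for x y
      by (auto simp: indicator_def dist_commute)
    have meas [measurable]: "{p :: (complex ^ 'n) \<times> (complex ^ 'n). dist (fst p) (snd p) < h} \<in> sets (borel \<Otimes>\<^sub>M borel)"
      unfolding borel_prod by (intro borel_open open_Collect_less continuous_intros)
    \<comment> \<open>Integration over all pairs shows that the two measures give balls of radius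
      \<open>h\<close> the same mass.\<close>
    have "d = (\<integral>\<^sup>+x. d \<partial>\<mu>)" by (simp add: one)
    also have "\<dots> = (\<integral>\<^sup>+x. emeasure \<nu> (ball x h) \<partial>\<mu>)"
      using c by (intro nn_integral_cong_AE) auto
    also have "\<dots> = (\<integral>\<^sup>+x. (\<integral>\<^sup>+y. ?K x y \<partial>\<nu>) \<partial>\<mu>)"
      by (simp add: K(1) ball)
    also have "\<dots> = (\<integral>\<^sup>+y. (\<integral>\<^sup>+x. ?K x y \<partial>\<mu>) \<partial>\<nu>)"
      by (rule Fubini'[symmetric]) simp
    also have "\<dots> = (\<integral>\<^sup>+y. emeasure \<mu> (ball y h) \<partial>\<nu>)"
      by (simp add: K(2) ball)
    also have "\<dots> = (\<integral>\<^sup>+y. c \<partial>\<nu>)"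
      using c by (intro nn_integral_cong_AE) auto
    also have "\<dots> = c" by (simp add: one)
    finally have dc: "d = c" .
    have "c * emeasure \<mu> A = (\<integral>\<^sup>+x. c * indicator A x \<partial>\<mu>)"
      by (simp add: nn_integral_cmult_indicator)
    also have "\<dots> = (\<integral>\<^sup>+x. indicator A x * emeasure \<nu> (ball x h) \<partial>\<mu>)"
      using c by (intro nn_integral_cong_AE) (auto simp: dc mult.commute)
    also have "\<dots> = (\<integral>\<^sup>+x. (\<integral>\<^sup>+y. indicator A x * ?K x y \<partial>\<nu>) \<partial>\<mu>)"
      by (subst nn_integral_cmult) (simp_all add: K(1) ball ball_sets borel_measurable_indicator)
    \<comment> \<open>A point within \<open>h\<close> of \<open>A\<close> lies in
      \<open>T h\<close>, so the restriction moves from the first variable to the second.\<close>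
    also have "\<dots> \<le> (\<integral>\<^sup>+x. (\<integral>\<^sup>+y. indicator (T h) y * ?K x y \<partial>\<nu>) \<partial>\<mu>)"
      by (intro nn_integral_mono) (auto simp: T_def indicator_def)
    also have "\<dots> = (\<integral>\<^sup>+y. (\<integral>\<^sup>+x. indicator (T h) y * ?K x y \<partial>\<mu>) \<partial>\<nu>)"
      by (rule Fubini'[symmetric]) simp
    also have "\<dots> = (\<integral>\<^sup>+y. indicator (T h) y * emeasure \<mu> (ball y h) \<partial>\<nu>)"
      by (subst nn_integral_cmult) (simp_all add: K(2) ball ball_sets borel_measurable_indicator)
    also have "\<dots> = (\<integral>\<^sup>+y. c * indicator (T h) y \<partial>\<nu>)"
      using c by (intro nn_integral_cong_AE) (auto simp: mult.commute)
    also have "\<dots> = c * emeasure \<nu> (T h)"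
      by (simp add: nn_integral_cmult_indicator)
    finally show ?thesis
      using c0 by (simp add: ennreal_mult_le_mult_iff)
  qed
  \<comment> \<open>As \<open>A\<close> is closed, its neighbourhoods \<open>T h\<close> shrink to
    \<open>A\<close>, and continuity from above removes \<open>h\<close>.\<close>
  have dec: "decseq (\<lambda>k. T (1 / real (Suc k)))"
    unfolding decseq_def T_def by (force intro: order_less_le_trans simp: frac_le)
  have "(\<Inter>k. T (1 / real (Suc k))) = A"
  proof (intro equalityI subsetI)
    fix y assume y: "y \<in> (\<Inter>k. T (1 / real (Suc k)))"
    have "\<exists>x\<in>A. dist x y < r" if "r > 0" for r
    proof -
      obtain k where k: "1 / real (Suc k) < r" using \<open>r > 0\<close> by (meson nat_approx_posE)
      obtain x where "x \<in> A" "dist x y < 1 / real (Suc k)"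
        using y by (auto simp: T_def)
      then show ?thesis using k by force
    qed
    then have "y \<in> closure A" by (simp add: closure_approachable)
    then show "y \<in> A" using \<open>closed A\<close> by simp
  next
    fix y assume "y \<in> A"
    then show "y \<in> (\<Inter>k. T (1 / real (Suc k)))"
      by (auto simp: T_def intro!: bexI[of _ y])
  qed
  then have "(\<lambda>k. emeasure \<nu> (T (1 / real (Suc k)))) \<longlonglongrightarrow> emeasure \<nu> A"
    using Lim_emeasure_decseq[OF _ dec] by (simp add: image_subset_iff)
  then show ?thesis
    by (rule LIMSEQ_le_const) (auto intro!: exI[of _ 0] le)
qed

theorem haar_sphere_unique:
  fixes \<mu> \<nu> :: "(complex ^ 'n) measure"
  assumes \<mu>: "haar_sphere \<mu>" and \<nu>: "haar_sphere \<nu>"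
  shows "\<mu> = \<nu>"
proof (rule measure_eqI_generator_eq[where E = "Collect closed" and \<Omega> = UNIV and A = "\<lambda>_. UNIV"])
  show "sets \<mu> = sigma_sets UNIV (Collect closed)" "sets \<nu> = sigma_sets UNIV (Collect closed)"
    using \<mu> \<nu> by (auto simp: haar_sphere_def borel_eq_closed)
  show "emeasure \<mu> X = emeasure \<nu> X" if "X \<in> Collect closed" for X
    using that haar_sphere_closed_le[OF \<mu> \<nu>] haar_sphere_closed_le[OF \<nu> \<mu>] by (auto intro: antisym)
  show "emeasure \<mu> UNIV \<noteq> \<infinity>"
    using \<mu> by (metis haar_sphere_def prob_space_def finite_measure.emeasure_finite infinity_ennreal_def prob_space.axioms(1))
qed (auto simp: Int_stable_def closed_Int)

section \<open>Gaussian integrals\<close>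

lemma lborel_prod_integral:
  fixes f :: "'a :: euclidean_space \<Rightarrow> real \<Rightarrow> 'b :: {real_normed_field, banach, second_countable_topology}"
  assumes f: "\<And>b. b \<in> Basis \<Longrightarrow> integrable lborel (f b)"
  shows "has_bochner_integral lborel (\<lambda>x. \<Prod>b\<in>Basis. f b (x \<bullet> b)) (\<Prod>b\<in>Basis. integral\<^sup>L lborel (f b))"
proof -
  interpret product_sigma_finite "\<lambda>_. lborel :: real measure"
    by standard
  have [measurable]: "f b \<in> borel_measurable borel" if "b \<in> Basis" for b
    using f[OF that] by simp
  have meas: "(\<lambda>x. \<Prod>b\<in>Basis. f b (x \<bullet> b)) \<in> borel_measurable borel"
    by measurable
  let ?T = "\<lambda>x. \<Sum>b\<in>Basis. x b *\<^sub>R b :: 'a"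
  have T: "?T \<in> measurable (\<Pi>\<^sub>M b\<in>Basis. lborel) borel"
    by measurable
  have eq: "(\<Prod>b\<in>Basis. f b (?T x \<bullet> b)) = (\<Prod>b\<in>Basis. f b (x b))" for x
    by (intro prod.cong) simp_all
  have "integrable (\<Pi>\<^sub>M b\<in>Basis. lborel) (\<lambda>x. \<Prod>b\<in>Basis. f b (x b))"
    by (rule product_integrable_prod) (use f in auto)
  moreover have "(\<integral>x. (\<Prod>b\<in>Basis. f b (x b)) \<partial>(\<Pi>\<^sub>M b\<in>Basis. lborel)) = (\<Prod>b\<in>Basis. integral\<^sup>L lborel (f b))"
    by (rule product_integral_prod) (use f in auto)
  ultimately show ?thesis
    unfolding has_bochner_integral_iff
    by (subst (1 2) lborel_eq) (simp add: integrable_distr_eq[OF T meas] integral_distr[OF T meas] eq)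
qed

section \<open>Gaussian integrals on the line\<close>

lemma gaussian_integral:
  assumes "a > 0"
  shows "has_bochner_integral lborel (\<lambda>x. exp (- (a * x\<^sup>2))) (sqrt (pi / a))"
proof -
  define s where "s = 1 / sqrt (2 * a)"
  have s: "s > 0" "s\<^sup>2 = 1 / (2 * a)" using assms by (simp_all add: s_def power_divide)
  have "has_bochner_integral lborel (normal_density 0 s) 1"
    using s by (simp add: has_bochner_integral_iff)
  then have "has_bochner_integral lborel (\<lambda>x. sqrt (pi / a) * normal_density 0 s x) (sqrt (pi / a) * 1)"
    by (rule has_bochner_integral_mult_right)
  moreover have "sqrt (pi / a) * normal_density 0 s x = exp (- (a * x\<^sup>2))" for x
    using assms by (simp add: normal_density_def s(2) real_sqrt_divide)
  ultimately show ?thesis by simp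
qed

lemma gaussian_fourier:
  assumes "a > 0"
  shows "(\<integral>x. complex_of_real (exp (- (a * x\<^sup>2))) * iexp (t * x) \<partial>lborel)
    = complex_of_real (sqrt (pi / a) * exp (- (t\<^sup>2 / (4 * a))))"
proof -
  define s where "s = sqrt (2 * a)"
  have s: "s > 0" "s\<^sup>2 = 2 * a" using assms by (simp_all add: s_def)
  have "complex_of_real (exp (- ((t / s)\<^sup>2) / 2)) = char std_normal_distribution (t / s)"
    by (simp add: char_std_normal_distribution)
  also have "\<dots> = (\<integral>x. std_normal_density x *\<^sub>R iexp (t / s * x) \<partial>lborel)"
    unfolding char_def by (rule integral_density) auto
  also have "\<dots> = \<bar>s\<bar> *\<^sub>R (\<integral>x. std_normal_density (0 + s * x) *\<^sub>R iexp (t / s * (0 + s * x)) \<partial>lborel)"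
    using s by (intro lborel_integral_real_affine) auto
  also have "\<dots> = s *\<^sub>R (\<integral>x. complex_of_real (1 / sqrt (2 * pi)) * (complex_of_real (exp (- (a * x\<^sup>2))) * iexp (t * x)) \<partial>lborel)"
    using s by (simp add: std_normal_density_def scaleR_conv_of_real power_mult_distrib mult.assoc)
  also have "\<dots> = complex_of_real (s / sqrt (2 * pi)) * (\<integral>x. complex_of_real (exp (- (a * x\<^sup>2))) * iexp (t * x) \<partial>lborel)"
    by (simp add: scaleR_conv_of_real)
  finally have "complex_of_real (sqrt (2 * pi) / s) * complex_of_real (exp (- ((t / s)\<^sup>2) / 2))
      = (\<integral>x. complex_of_real (exp (- (a * x\<^sup>2))) * iexp (t * x) \<partial>lborel)"
    using s by simp
  moreover have "sqrt (2 * pi) / s = sqrt (pi / a)"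
    using assms by (simp add: s_def real_sqrt_divide real_sqrt_mult)
  moreover have "- ((t / s)\<^sup>2) / 2 = - (t\<^sup>2 / (4 * a))"
    using s by (simp add: power_divide)
  ultimately show ?thesis by simp
qed

text \<open>Writing the squared modulus as a double integral, the shears \<open>x = y + u\<close>, \<open>y = v - u/2\<close>
  turn \<open>x\<^sup>2 - y\<^sup>2\<close> into \<open>2uv\<close>, and the integral in \<open>v\<close> is an ordinary Fourier transform.\<close>

lemma gaussian_quadratic_phase:
  fixes t :: real
  defines "I \<equiv> \<integral>x. complex_of_real (exp (- x\<^sup>2)) * iexp (t * x\<^sup>2) \<partial>lborel"
  shows "(cmod I)\<^sup>2 = pi / sqrt (1 + t\<^sup>2)"
proof -
  define g where "g x = complex_of_real (exp (- x\<^sup>2)) * iexp (t * x\<^sup>2)" for x :: real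
  have [measurable]: "g \<in> borel_measurable borel" by (simp add: g_def[abs_def])
  have norm_g: "norm (g x) = exp (- x\<^sup>2)" for x by (simp add: g_def norm_mult)
  have e: "integrable lborel (\<lambda>x::real. exp (- x\<^sup>2))"
    using gaussian_integral[of 1] by (simp add: has_bochner_integral_iff)
  have e_shift: "integrable lborel (\<lambda>x. exp (- (c + x)\<^sup>2))"
      "(\<integral>x. exp (- (c + x)\<^sup>2) \<partial>lborel) = sqrt pi" for c :: real
    using lborel_integrable_real_affine[OF e, of 1 c] gaussian_integral[of 1]
      lborel_integral_real_affine[of 1 "\<lambda>x. exp (- x\<^sup>2)" c]
    by (simp_all add: has_bochner_integral_iff)
  have int_g: "integrable lborel g"
    by (rule Bochner_Integration.integrable_bound[OF e]) (auto simp: norm_g)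
  define h where "h y u = g (y + u) * cnj (g y)" for y u
  have [measurable]: "cnj \<in> borel_measurable borel"
    by (intro borel_measurable_continuous_onI continuous_intros)
  have [measurable]: "(\<lambda>p. h (fst p) (snd p)) \<in> borel_measurable (lborel \<Otimes>\<^sub>M lborel)"
    unfolding h_def by measurable
  have norm_h: "norm (h y u) = exp (- (y + u)\<^sup>2) * exp (- y\<^sup>2)" for y u
    by (simp add: h_def norm_mult norm_g)
  have int_h: "integrable (lborel \<Otimes>\<^sub>M lborel) (\<lambda>(y, u). h y u)"
  proof (rule lborel_pair.Fubini_integrable)
    show "integrable lborel (\<lambda>y. \<integral>u. norm ((\<lambda>(y, u). h y u) (y, u)) \<partial>lborel)"
      using e by (simp add: norm_h e_shift)
    have [measurable]: "h y \<in> borel_measurable borel" for y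
      by (simp add: h_def[abs_def])
    have "integrable lborel (\<lambda>u. h y u)" for y
      by (rule Bochner_Integration.integrable_bound[where f = "\<lambda>u. exp (- (y + u)\<^sup>2) * exp (- y\<^sup>2)"])
        (simp_all add: norm_h e_shift)
    then show "AE y in lborel. integrable lborel (\<lambda>u. (\<lambda>(y, u). h y u) (y, u))" by simp
  qed (simp add: split_beta')
  have I_eq: "I = integral\<^sup>L lborel g" by (simp add: I_def g_def[abs_def])
  have "I * cnj I = (\<integral>y. I * cnj (g y) \<partial>lborel)"
    by (simp add: I_eq)
  also have "\<dots> = (\<integral>y. (\<integral>u. h y u \<partial>lborel) \<partial>lborel)"
  proof (rule Bochner_Integration.integral_cong[OF refl])
    fix y
    have "I = (\<integral>u. g (y + u) \<partial>lborel)"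
      using lborel_integral_real_affine[of 1 g y] by (simp add: I_def g_def[abs_def])
    then show "I * cnj (g y) = (\<integral>u. h y u \<partial>lborel)"
      by (simp add: h_def)
  qed
  also have "\<dots> = (\<integral>u. (\<integral>y. h y u \<partial>lborel) \<partial>lborel)"
    by (rule lborel_pair.Fubini_integral[symmetric, OF int_h])
  also have "\<dots> = (\<integral>u. complex_of_real (sqrt (pi / 2) * exp (- ((1 + t\<^sup>2) / 2 * u\<^sup>2))) \<partial>lborel)"
  proof (rule Bochner_Integration.integral_cong[OF refl])
    fix u :: real
    have "(\<integral>y. h y u \<partial>lborel) = (\<integral>v. h (- (u / 2) + v) u \<partial>lborel)"
      using lborel_integral_real_affine[of 1 "\<lambda>y. h y u" "- (u / 2)"] by simp
    also have "\<dots> = (\<integral>v. complex_of_real (exp (- (u\<^sup>2 / 2))) * (complex_of_real (exp (- (2 * v\<^sup>2))) * iexp ((2 * t * u) * v)) \<partial>lborel)"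
    proof (rule Bochner_Integration.integral_cong[OF refl])
      fix v :: real
      have "h (- (u / 2) + v) u = complex_of_real (exp (- (v + u / 2)\<^sup>2) * exp (- (v - u / 2)\<^sup>2))
          * (iexp (t * (v + u / 2)\<^sup>2) * iexp (- (t * (v - u / 2)\<^sup>2)))"
        by (simp add: h_def g_def exp_cnj algebra_simps)
      also have "exp (- (v + u / 2)\<^sup>2) * exp (- (v - u / 2)\<^sup>2) = exp (- (u\<^sup>2 / 2)) * exp (- (2 * v\<^sup>2))"
        by (simp add: power2_eq_square algebra_simps flip: exp_add)
      also have "iexp (t * (v + u / 2)\<^sup>2) * iexp (- (t * (v - u / 2)\<^sup>2)) = iexp (t * (v + u / 2)\<^sup>2 + - (t * (v - u / 2)\<^sup>2))"
        by (simp add: mult_exp_exp ring_distribs)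
      also have "t * (v + u / 2)\<^sup>2 + - (t * (v - u / 2)\<^sup>2) = (2 * t * u) * v"
        by (simp add: power2_eq_square algebra_simps)
      finally show "h (- (u / 2) + v) u = complex_of_real (exp (- (u\<^sup>2 / 2)))
          * (complex_of_real (exp (- (2 * v\<^sup>2))) * iexp ((2 * t * u) * v))"
        by simp
    qed
    also have "\<dots> = complex_of_real (exp (- (u\<^sup>2 / 2))) * complex_of_real (sqrt (pi / 2) * exp (- ((2 * t * u)\<^sup>2 / (4 * 2))))"
      using gaussian_fourier[of 2 "2 * t * u"] by simp
    also have "\<dots> = complex_of_real (sqrt (pi / 2) * (exp (- (u\<^sup>2 / 2)) * exp (- ((2 * t * u)\<^sup>2 / (4 * 2)))))"
      by simp
    also have "exp (- (u\<^sup>2 / 2)) * exp (- ((2 * t * u)\<^sup>2 / (4 * 2))) = exp (- ((1 + t\<^sup>2) / 2 * u\<^sup>2))"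
      by (simp add: power2_eq_square algebra_simps add_divide_distrib flip: exp_add)
    finally show "(\<integral>y. h y u \<partial>lborel) = complex_of_real (sqrt (pi / 2) * exp (- ((1 + t\<^sup>2) / 2 * u\<^sup>2)))" .
  qed
  also have "\<dots> = complex_of_real (\<integral>u. sqrt (pi / 2) * exp (- ((1 + t\<^sup>2) / 2 * u\<^sup>2)) \<partial>lborel)"
    by (rule integral_complex_of_real)
  also have "(\<integral>u. sqrt (pi / 2) * exp (- ((1 + t\<^sup>2) / 2 * u\<^sup>2)) \<partial>lborel) = sqrt (pi / 2) * sqrt (pi / ((1 + t\<^sup>2) / 2))"
    using gaussian_integral[of "(1 + t\<^sup>2) / 2"]
    by (simp add: has_bochner_integral_iff add_pos_nonneg)
  also have "\<dots> = pi / sqrt (1 + t\<^sup>2)"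
    by (simp add: real_sqrt_divide real_sqrt_mult)
  finally have "complex_of_real ((cmod I)\<^sup>2) = complex_of_real (pi / sqrt (1 + t\<^sup>2))"
    by (simp add: complex_norm_square del: of_real_power)
  then show ?thesis using of_real_eq_iff by blast
qed

section \<open>Gaussian integrals over complex vectors\<close>

lemma prod_Basis_vec:
  "(\<Prod>b\<in>(Basis :: (complex ^ 'n) set). F b) = (\<Prod>i\<in>UNIV. F (axis i 1) * F (axis i \<i>))"
proof -
  have "(\<Prod>b\<in>(Basis :: (complex ^ 'n) set). F b) = (\<Prod>i\<in>UNIV. \<Prod>b\<in>{axis i 1, axis i \<i>}. F b)"
    unfolding Basis_vec_def Basis_complex_def
    by (subst prod.UNION_disjoint[symmetric]) (auto simp: axis_eq_axis intro!: prod.cong)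
  also have "\<dots> = (\<Prod>i\<in>UNIV. F (axis i 1) * F (axis i \<i>))"
    by (intro prod.cong) (simp_all add: axis_eq_axis)
  finally show ?thesis .
qed

lemma lborel_complex_vec_integral:
  fixes f :: "'n :: finite \<Rightarrow> real \<Rightarrow> 'b :: {real_normed_field, banach, second_countable_topology}"
  assumes f: "\<And>i. integrable lborel (f i)"
  shows "has_bochner_integral lborel (\<lambda>x :: complex ^ 'n. \<Prod>i\<in>UNIV. f i (Re (x $ i)) * f i (Im (x $ i)))
    (\<Prod>i\<in>UNIV. (integral\<^sup>L lborel (f i))\<^sup>2)"
proof -
  \<comment> \<open>Recovers the coordinate to which a real basis vector belongs. The real and the
    imaginary axis share it, whence the squares in the product.\<close>
  define index where "index b = (SOME i. b $ i \<noteq> 0)" for b :: "complex ^ 'n"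
  have index: "index (axis i c) = i" if "c \<noteq> 0" for i c
    using that by (simp add: index_def axis_def)
  have "has_bochner_integral lborel (\<lambda>x :: complex ^ 'n. \<Prod>b\<in>Basis. f (index b) (x \<bullet> b))
      (\<Prod>b\<in>(Basis :: (complex ^ 'n) set). integral\<^sup>L lborel (f (index b)))"
    by (rule lborel_prod_integral) (rule f)
  then show ?thesis
    by (simp add: prod_Basis_vec index inner_axis power2_eq_square inner_complex_def)
qed

lemma norm_vec_square: "(norm (x :: complex ^ 'n))\<^sup>2 = (\<Sum>i\<in>UNIV. (Re (x $ i))\<^sup>2 + (Im (x $ i))\<^sup>2)"
  by (simp add: norm_vec_def L2_set_def sum_nonneg cmod_power2)

lemma gaussian_integral_vec:
  assumes "a > 0"
  shows "has_bochner_integral lborel (\<lambda>x :: complex ^ 'n. exp (- (a * (norm x)\<^sup>2))) ((pi / a) ^ CARD('n))"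
proof -
  have "integrable lborel (\<lambda>x. exp (- (a * x\<^sup>2)))"
    using gaussian_integral[OF assms] by (simp add: has_bochner_integral_iff)
  from lborel_complex_vec_integral[where 'n = 'n, of "\<lambda>_ x. exp (- (a * x\<^sup>2))", OF this]
  have "has_bochner_integral lborel
      (\<lambda>x :: complex ^ 'n. \<Prod>i\<in>UNIV. exp (- (a * (Re (x $ i))\<^sup>2)) * exp (- (a * (Im (x $ i))\<^sup>2)))
      ((pi / a) ^ CARD('n))"
    using gaussian_integral[OF assms] assms by (simp add: has_bochner_integral_iff)
  moreover have "(\<Prod>i\<in>UNIV. exp (- (a * (Re (x $ i))\<^sup>2)) * exp (- (a * (Im (x $ i))\<^sup>2)))
      = exp (- (a * (norm x)\<^sup>2))" for x :: "complex ^ 'n"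
  proof -
    have "- (a * (norm x)\<^sup>2) = (\<Sum>i\<in>UNIV. - (a * (Re (x $ i))\<^sup>2) + - (a * (Im (x $ i))\<^sup>2))"
      by (simp add: norm_vec_square sum_distrib_left ring_distribs flip: sum_negf)
    then show ?thesis by (simp add: exp_sum mult_exp_exp)
  qed
  ultimately show ?thesis by simp
qed

text \<open>Each complex coordinate contributes the square of a one-dimensional phase integral.
  Passing to moduli avoids the choice of a complex square root.\<close>

lemma gaussian_diagonal_phase:
  fixes d :: "'n :: finite \<Rightarrow> real"
  shows "cmod (\<integral>x. complex_of_real (exp (- (norm (x :: complex ^ 'n))\<^sup>2)) * iexp (\<Sum>i\<in>UNIV. d i * (cmod (x $ i))\<^sup>2) \<partial>lborel)
    = pi ^ CARD('n) * (\<Prod>i\<in>UNIV. 1 / sqrt (1 + (d i)\<^sup>2))"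
proof -
  let ?f = "\<lambda>i x. complex_of_real (exp (- x\<^sup>2)) * iexp (d i * x\<^sup>2)"
  have e: "integrable lborel (\<lambda>x::real. exp (- x\<^sup>2))"
    using gaussian_integral[of 1] by (simp add: has_bochner_integral_iff)
  have f: "integrable lborel (?f i)" for i
    by (rule Bochner_Integration.integrable_bound[OF e]) (auto simp: norm_mult)
  have "(\<Prod>i\<in>UNIV. ?f i (Re (x $ i)) * ?f i (Im (x $ i)))
      = complex_of_real (exp (- (norm x)\<^sup>2)) * iexp (\<Sum>i\<in>UNIV. d i * (cmod (x $ i))\<^sup>2)" for x :: "complex ^ 'n"
  proof -
    have "?f i (Re (x $ i)) * ?f i (Im (x $ i))
        = complex_of_real (exp (- (cmod (x $ i))\<^sup>2)) * iexp (d i * (cmod (x $ i))\<^sup>2)" for i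
      unfolding cmod_power2 minus_add_distrib exp_add of_real_add of_real_mult ring_distribs by simp
    then show ?thesis
      by (simp add: prod.distrib exp_sum norm_vec_square cmod_power2 sum_distrib_left flip: sum_negf)
  qed
  then have "(\<integral>x. complex_of_real (exp (- (norm (x :: complex ^ 'n))\<^sup>2)) * iexp (\<Sum>i\<in>UNIV. d i * (cmod (x $ i))\<^sup>2) \<partial>lborel)
      = (\<Prod>i\<in>UNIV. (integral\<^sup>L lborel (?f i))\<^sup>2)"
    using lborel_complex_vec_integral[where 'n = 'n, of ?f, OF f] by (simp add: has_bochner_integral_iff)
  also have "cmod \<dots> = (\<Prod>i\<in>UNIV. pi / sqrt (1 + (d i)\<^sup>2))"
    using gaussian_quadratic_phase by (simp add: norm_power flip: prod_norm)
  finally show ?thesis by (simp add: prod_dividef)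
qed

section \<open>Anti-concentration\<close>

definition gauss :: "(complex ^ 'n) measure"
  where "gauss = density lborel (\<lambda>x. ennreal (exp (- (norm x)\<^sup>2) / pi ^ CARD('n)))"

lemma space_gauss [simp]: "space gauss = UNIV" and sets_gauss [simp, measurable_cong]: "sets gauss = sets borel"
  by (simp_all add: gauss_def)

lemma prob_space_gauss: "prob_space (gauss :: (complex ^ 'n) measure)"
proof
  have "has_bochner_integral lborel (\<lambda>x :: complex ^ 'n. exp (- (norm x)\<^sup>2) / pi ^ CARD('n)) 1"
    using gaussian_integral_vec[of 1, where 'n = 'n] by (simp add: has_bochner_integral_iff)
  then have i: "integrable lborel (\<lambda>x :: complex ^ 'n. exp (- (norm x)\<^sup>2) / pi ^ CARD('n))"
      "(\<integral>x. exp (- (norm (x :: complex ^ 'n))\<^sup>2) / pi ^ CARD('n) \<partial>lborel) = 1"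
    unfolding has_bochner_integral_iff by blast+
  have "(\<integral>\<^sup>+x. ennreal (exp (- (norm (x :: complex ^ 'n))\<^sup>2) / pi ^ CARD('n)) \<partial>lborel) = 1"
    by (subst nn_integral_eq_integral[OF i(1)], simp, simp only: i(2) ennreal_1)
  then show "emeasure gauss (space (gauss :: (complex ^ 'n) measure)) = 1"
    by (simp add: gauss_def emeasure_density)
qed

text \<open>The density is kept general because the lemma is applied both to the Gaussian and to its
  restriction to a centred ball.\<close>

lemma distr_density_unitary:
  fixes h :: "complex ^ 'n \<Rightarrow> ennreal"
  assumes U: "unitary U" and [measurable]: "h \<in> borel_measurable borel" and h: "\<And>x. h (U *v x) = h x"
  shows "distr (density lborel h) borel ((*v) U) = density lborel h"
proof (rule measure_eqI)
  fix A assume "A \<in> sets (distr (density lborel h) borel ((*v) U))"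
  then have A [measurable]: "A \<in> sets borel" by simp
  have "emeasure (distr (density lborel h) borel ((*v) U)) A = emeasure (density lborel h) ((*v) U -` A)"
    by (simp add: emeasure_distr)
  also have "\<dots> = (\<integral>\<^sup>+x. h x * indicator ((*v) U -` A) x \<partial>lborel)"
    by (rule emeasure_density) (use measurable_sets[OF borel_measurable_matrix_vector A] in auto)
  also have "\<dots> = (\<integral>\<^sup>+x. h (U *v x) * indicator A (U *v x) \<partial>lborel)"
    by (simp add: h indicator_def)
  also have "\<dots> = (\<integral>\<^sup>+x. h x * indicator A x \<partial>lborel)"
    by (rule nn_integral_lborel_isometry[where f = "(*v) U"]) (simp_all add: linear_matrix_vector unitary_norm U)
  also have "\<dots> = emeasure (density lborel h) A"
    by (simp add: emeasure_density)
  finally show "emeasure (distr (density lborel h) borel ((*v) U)) A = emeasure (density lborel h) A" .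
qed simp

lemma distr_gauss_unitary:
  assumes "unitary U"
  shows "distr gauss borel ((*v) U) = gauss"
  unfolding gauss_def by (rule distr_density_unitary) (simp_all add: assms unitary_norm)

lemma gauss_integral:
  fixes f :: "complex ^ 'n \<Rightarrow> 'b :: {banach, second_countable_topology}"
  assumes [measurable]: "f \<in> borel_measurable borel"
  shows "integral\<^sup>L gauss f = (\<integral>x. (exp (- (norm x)\<^sup>2) / pi ^ CARD('n)) *\<^sub>R f x \<partial>lborel)"
  unfolding gauss_def by (rule integral_density) auto

text \<open>Chernoff bound: half of the exponent is traded for \<open>exp (- (R / 2))\<close>, and
  the remaining Gaussian, of doubled variance, has total mass \<open>2 ^ CARD('n)\<close>. The
  squared norm has mean \<open>CARD('n)\<close>.\<close>

lemma gauss_tail: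
  "measure gauss {x :: complex ^ 'n. R < (norm x)\<^sup>2} \<le> 2 ^ CARD('n) * exp (- (R / 2))"
proof -
  interpret prob_space "gauss :: (complex ^ 'n) measure" by (rule prob_space_gauss)
  let ?A = "{x :: complex ^ 'n. R < (norm x)\<^sup>2}"
  have [measurable]: "?A \<in> sets borel" by simp
  have g: "has_bochner_integral lborel (\<lambda>x :: complex ^ 'n. exp (- (norm x)\<^sup>2 / 2)) ((2 * pi) ^ CARD('n))"
    using gaussian_integral_vec[of "1 / 2", where 'n = 'n] by (simp add: mult.commute)
  have "measure gauss ?A = (\<integral>x. indicator ?A x \<partial>gauss)" by simp
  also have "\<dots> = (\<integral>x. (exp (- (norm x)\<^sup>2) / pi ^ CARD('n)) *\<^sub>R indicator ?A x \<partial>lborel)"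
    by (rule gauss_integral) simp
  also have "\<dots> \<le> (\<integral>x. exp (- (R / 2)) / pi ^ CARD('n) * exp (- (norm (x :: complex ^ 'n))\<^sup>2 / 2) \<partial>lborel)"
  proof (rule integral_mono_AE')
    show "integrable lborel (\<lambda>x :: complex ^ 'n. exp (- (R / 2)) / pi ^ CARD('n) * exp (- (norm x)\<^sup>2 / 2))"
      using g by (simp add: has_bochner_integral_iff)
    have "exp (- (norm x)\<^sup>2) \<le> exp (- (R / 2)) * exp (- (norm x)\<^sup>2 / 2)" if "R < (norm x)\<^sup>2" for x :: "complex ^ 'n"
      using that by (simp flip: exp_add)
    then show "AE x in lborel. (exp (- (norm x)\<^sup>2) / pi ^ CARD('n)) *\<^sub>R indicator ?A x
        \<le> exp (- (R / 2)) / pi ^ CARD('n) * exp (- (norm x)\<^sup>2 / 2)"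
      by (intro AE_I2) (auto simp: indicator_def intro!: divide_right_mono)
  qed (auto simp: indicator_def)
  also have "\<dots> = exp (- (R / 2)) / pi ^ CARD('n) * (2 * pi) ^ CARD('n)"
    using g by (simp add: has_bochner_integral_iff)
  finally show ?thesis by (simp add: power_mult_distrib mult.commute)
qed

lemma borel_measurable_cinner_matrix [measurable]:
  "(\<lambda>x. cinner x (M *v x)) \<in> borel_measurable borel"
proof -
  have "continuous_on UNIV (\<lambda>x. cinner x (M *v x))"
    unfolding cinner_def matrix_vector_mult_def by (intro continuous_intros)
  then show ?thesis by (rule borel_measurable_continuous_onI)
qed

text \<open>Unitary invariance of the Gaussian replaces \<open>H\<close> by its diagonal
  form.\<close>

lemma gauss_hermitian_phase:
  fixes H :: "complex ^ 'n ^ 'n"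
  assumes U: "unitary U" and H: "H = U ** diag_matrix (\<lambda>i. complex_of_real (d i)) ** conj_transpose U"
  shows "cmod (\<integral>x. iexp (Re (cinner x (H *v x))) \<partial>gauss) = (\<Prod>i\<in>UNIV. 1 / sqrt (1 + (d i)\<^sup>2))"
proof -
  have q: "Re (cinner (U *v x) (H *v (U *v x))) = (\<Sum>i\<in>UNIV. d i * (cmod (x $ i))\<^sup>2)" for x
  proof -
    have "H *v (U *v x) = U *v (diag_matrix (\<lambda>i. complex_of_real (d i)) *v (conj_transpose U ** U *v x))"
      by (simp add: H matrix_vector_mul_assoc matrix_mul_assoc)
    then have "H *v (U *v x) = U *v (diag_matrix (\<lambda>i. complex_of_real (d i)) *v x)"
      using U by (simp add: unitary_def)
    then show ?thesis
      by (simp only: unitary_cinner[OF U] cinner_diag_matrix Re_complex_of_real)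
  qed
  have [measurable]: "(\<lambda>x. iexp (Re (cinner x (H *v x)))) \<in> borel_measurable borel"
    by measurable
  have "(\<integral>x. iexp (Re (cinner x (H *v x))) \<partial>gauss)
      = (\<integral>x. iexp (Re (cinner x (H *v x))) \<partial>distr gauss borel ((*v) U))"
    by (simp add: distr_gauss_unitary U)
  also have "\<dots> = (\<integral>x. iexp (Re (cinner (U *v x) (H *v (U *v x)))) \<partial>gauss)"
    by (rule integral_distr) simp_all
  also have "\<dots> = (\<integral>x. iexp (\<Sum>i\<in>UNIV. d i * (cmod (x $ i))\<^sup>2) \<partial>gauss)"
    by (simp only: q)
  also have "\<dots> = (\<integral>x. (exp (- (norm x)\<^sup>2) / pi ^ CARD('n)) *\<^sub>R iexp (\<Sum>i\<in>UNIV. d i * (cmod (x $ i))\<^sup>2) \<partial>lborel)"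
    by (intro gauss_integral borel_measurable_continuous_onI continuous_intros)
  also have "\<dots> = (\<integral>x. complex_of_real (1 / pi ^ CARD('n)) * (complex_of_real (exp (- (norm (x :: complex ^ 'n))\<^sup>2)) * iexp (\<Sum>i\<in>UNIV. d i * (cmod (x $ i))\<^sup>2)) \<partial>lborel)"
    by (simp add: scaleR_conv_of_real)
  also have "\<dots> = complex_of_real (1 / pi ^ CARD('n)) * (\<integral>x. complex_of_real (exp (- (norm (x :: complex ^ 'n))\<^sup>2)) * iexp (\<Sum>i\<in>UNIV. d i * (cmod (x $ i))\<^sup>2) \<partial>lborel)"
    by (rule integral_mult_right_zero)
  also have "cmod \<dots> = 1 / pi ^ CARD('n) * (pi ^ CARD('n) * (\<Prod>i\<in>UNIV. 1 / sqrt (1 + (d i)\<^sup>2)))"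
    unfolding norm_mult gaussian_diagonal_phase norm_of_real by simp
  finally show ?thesis by simp
qed

lemma sgn_matrix_vector:
  assumes "unitary U"
  shows "sgn (U *v x) = U *v sgn (x :: complex ^ 'n)"
  by (simp add: sgn_div_norm unitary_norm assms scaleR_eq_scale vec.scale)

text \<open>Conditioning on a centred ball preserves unitary invariance, and \<open>sgn\<close>
  commutes with unitary maps. The ball gives control of the norm without a separate proof that norm
  and direction are independent.\<close>

lemma haar_sphere_gauss_cball:
  assumes pos: "measure gauss (cball 0 r :: (complex ^ 'n) set) > 0"
  shows "haar_sphere (distr (uniform_measure gauss (cball 0 r :: (complex ^ 'n) set)) borel sgn)"
proof -
  interpret prob_space "gauss :: (complex ^ 'n) measure" by (rule prob_space_gauss)
  let ?B = "cball 0 r :: (complex ^ 'n) set"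
  have B0: "emeasure gauss ?B \<noteq> 0" using pos by (auto simp: measure_def)
  define N where "N = uniform_measure gauss ?B"
  interpret N: prob_space N
    unfolding N_def using B0 by (intro prob_space_uniform_measure) auto
  have [measurable_cong]: "sets N = sets borel" by (simp add: N_def)
  have [simp]: "space N = UNIV" by (simp add: N_def)
  have [measurable]: "(sgn :: complex ^ 'n \<Rightarrow> _) \<in> borel_measurable borel"
    unfolding sgn_div_norm[abs_def] by measurable
  have N_eq: "N = density lborel (\<lambda>x. ennreal (exp (- (norm x)\<^sup>2) / pi ^ CARD('n)) * (indicator ?B x / emeasure gauss ?B))"
    unfolding N_def uniform_measure_def by (subst (1) gauss_def) (intro density_density_eq borel_measurable_divide_ennreal borel_measurable_indicator borel_measurable_const; simp)
  have N_inv: "distr N borel ((*v) U) = N" if "unitary U" for U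
    unfolding N_eq by (rule distr_density_unitary) (simp_all add: that unitary_norm indicator_def)
  \<comment> \<open>\<open>sgn 0\<close> is 0 and lies off the sphere, so the origin has to be a
    null set.\<close>
  have "AE x in lborel. x \<noteq> (0 :: complex ^ 'n)" by (rule AE_lborel_singleton)
  then have "AE x in gauss. x \<noteq> (0 :: complex ^ 'n)"
    unfolding gauss_def by (simp add: AE_density)
  then have "AE x in N. x \<noteq> 0"
    unfolding N_def by (intro AE_uniform_measureI) auto
  then have "AE x in N. norm (sgn x) = 1"
    by eventually_elim (simp add: norm_sgn)
  then have "AE x in distr N borel sgn. norm x = 1"
    by (subst AE_distr_iff) auto
  moreover have "prob_space (distr N borel sgn)" by (rule N.prob_space_distr) simp
  moreover have "distr (distr N borel sgn) borel ((*v) U) = distr N borel sgn" if "unitary U" for U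
  proof -
    have "distr (distr N borel sgn) borel ((*v) U) = distr N borel ((*v) U \<circ> sgn)"
      by (rule distr_distr) simp_all
    also have "(*v) U \<circ> sgn = sgn \<circ> (*v) U"
      by (simp add: fun_eq_iff sgn_matrix_vector[OF that])
    also have "distr N borel (sgn \<circ> (*v) U) = distr (distr N borel ((*v) U)) borel sgn"
      by (rule distr_distr[symmetric]) simp_all
    finally show ?thesis by (simp add: N_inv that)
  qed
  ultimately show ?thesis unfolding haar_sphere_def N_def by simp
qed

section \<open>Decay of the phase integral and its averages\<close>

lemma prod_inverse_sqrt_le:
  fixes d :: "'n :: finite \<Rightarrow> real"
  assumes t: "0 \<le> t" "5 \<le> card {i. t \<le> \<bar>d i\<bar>}" and s: "0 \<le> s" "s \<le> \<bar>d k\<bar>"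
  shows "(\<Prod>i\<in>UNIV. 1 / sqrt (1 + (d i)\<^sup>2)) \<le> 1 / sqrt (1 + s\<^sup>2) * (1 / (1 + t\<^sup>2))"
proof -
  let ?f = "\<lambda>i. 1 / sqrt (1 + (d i)\<^sup>2)"
  have le: "?f i \<le> 1 / sqrt (1 + t\<^sup>2)" if "0 \<le> t" "t \<le> \<bar>d i\<bar>" for i t
  proof -
    have "t\<^sup>2 \<le> (d i)\<^sup>2" using that abs_le_square_iff[of t "d i"] by simp
    then show ?thesis by (intro divide_left_mono mult_pos_pos) (simp_all add: add_pos_nonneg)
  qed
  \<comment> \<open>The index \<open>k\<close> reserved for the disk may be one of the five. Two of
    the others give the integrable factor \<open>1 / (1 + t\<^sup>2)\<close>; every remaining factor
    is at most 1.\<close>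
  have "2 \<le> card ({i. t \<le> \<bar>d i\<bar>} - {k})"
    using t(2) by (auto simp: card_Diff_singleton_if)
  then obtain B where B: "B \<subseteq> {i. t \<le> \<bar>d i\<bar>} - {k}" "card B = 2"
    by (rule obtain_subset_with_card_n)
  have "(\<Prod>i\<in>UNIV. ?f i) = (\<Prod>i\<in>UNIV - insert k B. ?f i) * (\<Prod>i\<in>insert k B. ?f i)"
    by (rule prod.subset_diff) auto
  also have "\<dots> \<le> 1 * (\<Prod>i\<in>insert k B. ?f i)"
    by (intro mult_right_mono prod_le_1 prod_nonneg) (use le[of 0] in auto)
  also have "\<dots> = ?f k * (\<Prod>i\<in>B. ?f i)"
    using B(1) by (subst prod.insert) auto
  also have "\<dots> \<le> 1 / sqrt (1 + s\<^sup>2) * (\<Prod>i\<in>B. 1 / sqrt (1 + t\<^sup>2))"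
    using B(1) t s by (intro mult_mono prod_mono le prod_nonneg) (auto intro: le)
  also have "(\<Prod>i\<in>B. 1 / sqrt (1 + t\<^sup>2)) = 1 / (1 + t\<^sup>2)"
    using B(2) by (simp add: power_divide add_nonneg_nonneg)
  finally show ?thesis .
qed

text \<open>Split at modulus 1: inside, the density is at most 2/5 and the antiderivative evaluates
  the integral; outside, \<open>f\<close> is at most \<open>c\<close> and the total mass is
  1.\<close>

lemma std_normal_integral_le:
  fixes f F :: "real \<Rightarrow> real"
  assumes f: "continuous_on UNIV f" "\<And>x. 0 \<le> f x" "\<And>x. 1 \<le> \<bar>x\<bar> \<Longrightarrow> f x \<le> c"
    and F: "\<And>x. (F has_real_derivative f x) (at x)"
  shows "integral\<^sup>L std_normal_distribution f \<le> 2 / 5 * (F 1 - F (- 1)) + c"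
proof -
  have [measurable]: "f \<in> borel_measurable borel" using f(1) by (rule borel_measurable_continuous_onI)
  have c: "0 \<le> c" using f(2)[of 1] f(3)[of 1] by simp
  have ftc: "has_bochner_integral lborel (\<lambda>x. f x * indicator {- 1..1} x) (F 1 - F (- 1))"
    using f(1) F by (intro has_bochner_integral_FTC_Icc_real) (auto simp: continuous_on_eq_continuous_at)
  \<comment> \<open>6.25 is just below 2 pi, hence the density bound 2/5.\<close>
  have "(5 / 2)\<^sup>2 \<le> 2 * pi" using pi_approx by (simp add: power2_eq_square)
  then have "5 / 2 \<le> sqrt (2 * pi)" by (rule real_le_rsqrt)
  then have dens: "std_normal_density x \<le> 2 / 5" for x
  proof -
    have "std_normal_density x \<le> 1 / sqrt (2 * pi) * 1"
      unfolding std_normal_density_def by (intro mult_left_mono) auto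
    also have "\<dots> \<le> 1 / (5 / 2)"
      using \<open>5 / 2 \<le> sqrt (2 * pi)\<close> by (simp only: mult_1_right) (intro divide_left_mono, auto)
    finally show ?thesis by simp
  qed
  have "integral\<^sup>L std_normal_distribution f = (\<integral>x. std_normal_density x * f x \<partial>lborel)"
    by (subst integral_density) auto
  also have "\<dots> \<le> (\<integral>x. 2 / 5 * (f x * indicator {- 1..1} x) + c * std_normal_density x \<partial>lborel)"
  proof (rule integral_mono_AE')
    show "integrable lborel (\<lambda>x. 2 / 5 * (f x * indicator {- 1..1} x) + c * std_normal_density x)"
      using ftc by (simp add: has_bochner_integral_iff)
    have "std_normal_density x * f x \<le> 2 / 5 * (f x * indicator {- 1..1} x) + c * std_normal_density x" for x
    proof (cases "\<bar>x\<bar> \<le> 1")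
      case True
      then have "x \<in> {- 1..1}" by auto
      moreover have "std_normal_density x * f x \<le> 2 / 5 * f x"
        using dens f(2) by (intro mult_right_mono)
      ultimately show ?thesis using c by (simp add: add_increasing2)
    next
      case False
      then have "x \<notin> {- 1..1}" by auto
      moreover have "std_normal_density x * f x \<le> std_normal_density x * c"
        using False f(3) by (intro mult_left_mono) auto
      ultimately show ?thesis by (simp add: mult.commute)
    qed
    then show "AE x in lborel. std_normal_density x * f x
        \<le> 2 / 5 * (f x * indicator {- 1..1} x) + c * std_normal_density x" by simp
  qed (use f(2) c in \<open>auto intro!: AE_I2 add_nonneg_nonneg mult_nonneg_nonneg divide_nonneg_nonneg\<close>)
  also have "\<dots> = 2 / 5 * (F 1 - F (- 1)) + c"
    using ftc by (simp add: has_bochner_integral_iff)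
  finally show ?thesis .
qed

lemma arsinh_real_nonneg: "0 \<le> x \<Longrightarrow> 0 \<le> arsinh (x :: real)"
  by (simp add: arsinh_real_def add_increasing)

text \<open>The source of the logarithm: the integrand decays only like 1/(k |x|), with
  antiderivative \<open>arsinh (k * x) / k\<close>, and the normal density cuts it off.\<close>

lemma std_normal_inverse_sqrt_le:
  assumes k: "0 < k"
  shows "(\<integral>x. 1 / sqrt (1 + (k * x)\<^sup>2) \<partial>std_normal_distribution) \<le> (arsinh k + 1) / k"
proof -
  have pos: "0 < 1 + (k * x)\<^sup>2" for x by (simp add: add_pos_nonneg)
  have "(\<integral>x. 1 / sqrt (1 + (k * x)\<^sup>2) \<partial>std_normal_distribution)
      \<le> 2 / 5 * (arsinh (k * 1) / k - arsinh (k * - 1) / k) + 1 / k"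
  proof (rule std_normal_integral_le)
    show "continuous_on UNIV (\<lambda>x. 1 / sqrt (1 + (k * x)\<^sup>2))"
      using pos by (intro continuous_intros) (auto simp: less_imp_neq[symmetric])
    show "((\<lambda>x. arsinh (k * x) / k) has_real_derivative 1 / sqrt (1 + (k * x)\<^sup>2)) (at x)" for x
      using k by (auto intro!: derivative_eq_intros DERIV_chain2[OF arsinh_real_has_field_derivative] simp: add.commute)
    fix x :: real assume "1 \<le> \<bar>x\<bar>"
    then have "k\<^sup>2 \<le> (k * x)\<^sup>2" using k by (simp add: power_mult_distrib abs_le_square_iff[of 1 x, simplified])
    then have "k \<le> sqrt (1 + (k * x)\<^sup>2)" by (intro real_le_rsqrt) simp
    then show "1 / sqrt (1 + (k * x)\<^sup>2) \<le> 1 / k"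
      using k pos[of x] by (intro divide_left_mono mult_pos_pos) auto
  qed (auto simp: add_nonneg_nonneg)
  also have "\<dots> = (4 / 5 * arsinh k + 1) / k" using k by (simp add: field_simps)
  also have "\<dots> \<le> (arsinh k + 1) / k"
    using k by (intro divide_right_mono) (auto simp: arsinh_real_nonneg)
  finally show ?thesis .
qed

text \<open>No logarithm arises because arctan is bounded by pi/2. Outside [-1, 1] the inequality
  \<open>2 * k \<le> 1 + k\<^sup>2\<close> gives \<open>1 / (2 * k)\<close>, and 2 exceeds 2 pi/5 +
  1/2.\<close>

lemma std_normal_inverse_square_le:
  assumes k: "0 < k"
  shows "(\<integral>x. 1 / (1 + (k * x)\<^sup>2) \<partial>std_normal_distribution) \<le> 2 / k"
proof -
  have pos: "0 < 1 + (k * x)\<^sup>2" for x by (simp add: add_pos_nonneg)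
  have "(\<integral>x. 1 / (1 + (k * x)\<^sup>2) \<partial>std_normal_distribution)
      \<le> 2 / 5 * (arctan (k * 1) / k - arctan (k * - 1) / k) + 1 / (2 * k)"
  proof (rule std_normal_integral_le)
    show "continuous_on UNIV (\<lambda>x. 1 / (1 + (k * x)\<^sup>2))"
      using pos by (intro continuous_intros) (auto simp: less_imp_neq[symmetric])
    show "((\<lambda>x. arctan (k * x) / k) has_real_derivative 1 / (1 + (k * x)\<^sup>2)) (at x)" for x
      using k by (auto intro!: derivative_eq_intros simp: inverse_eq_divide)
    fix x :: real assume "1 \<le> \<bar>x\<bar>"
    then have "k\<^sup>2 \<le> (k * x)\<^sup>2" using k by (simp add: power_mult_distrib abs_le_square_iff[of 1 x, simplified])
    moreover have "2 * k \<le> 1 + k\<^sup>2" using sum_squares_bound[of k 1] by (simp add: add.commute)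
    ultimately have "2 * k \<le> 1 + (k * x)\<^sup>2" by simp
    then show "1 / (1 + (k * x)\<^sup>2) \<le> 1 / (2 * k)" using k pos[of x] by (intro divide_left_mono) auto
  qed (auto simp: add_nonneg_nonneg)
  also have "\<dots> = (4 / 5 * arctan k + 1 / 2) / k" using k by (simp add: arctan_minus field_simps)
  also have "\<dots> \<le> 2 / k"
    using k arctan_ubound[of k] pi_approx by (intro divide_right_mono) auto
  finally show ?thesis .
qed


text \<open>The indicator of the disk is dominated by a Gaussian, which is the Fourier transform of a
  Gaussian; the Fourier transform of the law of \<open>x\<^sup>* M x\<close> is then estimated along the hermitian parts.\<close>

lemma gauss_small_ball:
  fixes M :: "complex ^ 'n ^ 'n"
  assumes \<sigma>: "singular_value 9 M > 0" and ball: "ball c r \<subseteq> numerical_range M" and r: "0 < r"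
    and \<delta>: "0 < \<delta>"
  shows "measure gauss {x. cmod (cinner x (M *v x)) \<le> \<delta>}
    \<le> 8 * \<delta>\<^sup>2 * (arsinh (r / \<delta>) + 1) / (singular_value 9 M * r)"
proof -
  interpret G: prob_space "gauss :: (complex ^ 'n) measure" by (rule prob_space_gauss)
  define s where "s = singular_value 9 M"
  define N where "N = std_normal_distribution"
  interpret N: prob_space N unfolding N_def by (rule prob_space_normal_density) simp
  interpret NN: pair_prob_space N N ..
  interpret NN: prob_space "N \<Otimes>\<^sub>M N" by (rule NN.P.prob_space_axioms)
  interpret GN: pair_prob_space "gauss :: (complex ^ 'n) measure" "N \<Otimes>\<^sub>M N" ..
  interpret GN: prob_space "(gauss :: (complex ^ 'n) measure) \<Otimes>\<^sub>M (N \<Otimes>\<^sub>M N)" by (rule GN.P.prob_space_axioms)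
  have sets_N [measurable_cong]: "sets N = sets borel" by (simp add: N_def)
  obtain u where u: "cmod u = 1"
    and eig: "\<And>a b. \<exists>U d. unitary U
      \<and> hermitian_part (u * Complex a b) M = U ** diag_matrix (\<lambda>i. complex_of_real (d i)) ** conj_transpose U
      \<and> 5 \<le> card {i. s / 2 * \<bar>b\<bar> \<le> \<bar>d i\<bar>} \<and> (\<exists>i. r * \<bar>a\<bar> \<le> \<bar>d i\<bar>)"
    using hermitian_part_eigenvalues[OF \<sigma> ball r] unfolding s_def by blast
  \<comment> \<open>Multiplication by \<open>cnj u\<close> rotates the exceptional direction onto
    the real axis, so that \<open>X\<close> is paired with \<open>a\<close> and \<open>Y\<close>
    with \<open>b\<close>.\<close>
  define X where "X x = Re (cnj u * cinner x (M *v x))" for x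
  define Y where "Y x = Im (cnj u * cinner x (M *v x))" for x
  have [measurable]: "X \<in> borel_measurable borel" "Y \<in> borel_measurable borel"
    unfolding X_def[abs_def] Y_def[abs_def] by measurable
  have XY: "(X x)\<^sup>2 + (Y x)\<^sup>2 = (cmod (cinner x (M *v x)))\<^sup>2" for x
    unfolding X_def Y_def cmod_power2[symmetric] by (simp add: norm_mult u)
  \<comment> \<open>The frequency is treated as an independent standard normal pair \<open>p\<close>
    scaled by \<open>1 / \<delta>\<close>. All measures are then probability measures, and
    boundedness by 1 suffices for Fubini.\<close>
  define E where "E x p = iexp (fst p / \<delta> * X x + snd p / \<delta> * Y x)" for x and p :: "real \<times> real"
  have E_meas [measurable]: "(\<lambda>(x, p). E x p) \<in> borel_measurable (gauss \<Otimes>\<^sub>M (N \<Otimes>\<^sub>M N))"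
    unfolding E_def split_beta' by measurable
  have norm_E: "cmod (E x p) = 1" for x p by (simp add: E_def)
  have int_E: "integrable (gauss \<Otimes>\<^sub>M (N \<Otimes>\<^sub>M N)) (\<lambda>(x, p). E x p)"
    by (rule GN.integrable_const_bound[where B = 1]) (simp_all add: split_beta' norm_E)
  have char_E: "(\<integral>p. E x p \<partial>(N \<Otimes>\<^sub>M N)) = complex_of_real (exp (- (cmod (cinner x (M *v x)))\<^sup>2 / (2 * \<delta>\<^sup>2)))" for x
  proof -
    have "integrable (N \<Otimes>\<^sub>M N) (\<lambda>(a, b). E x (a, b))"
      by (rule NN.integrable_const_bound[where B = 1]) (simp_all add: split_beta' norm_E E_def)
    from NN.integral_fst'[OF this]
    have "(\<integral>p. E x p \<partial>(N \<Otimes>\<^sub>M N)) = (\<integral>a. (\<integral>b. E x (a, b) \<partial>N) \<partial>N)"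
      by simp
    also have "\<dots> = (\<integral>a. (\<integral>b. iexp (X x / \<delta> * a) * iexp (Y x / \<delta> * b) \<partial>N) \<partial>N)"
      by (simp add: E_def mult.commute ring_distribs flip: exp_add)
    also have "\<dots> = char N (X x / \<delta>) * char N (Y x / \<delta>)"
      by (simp add: char_def)
    also have "\<dots> = complex_of_real (exp (- ((X x / \<delta>)\<^sup>2) / 2) * exp (- ((Y x / \<delta>)\<^sup>2) / 2))"
      by (simp add: N_def char_std_normal_distribution)
    also have "exp (- ((X x / \<delta>)\<^sup>2) / 2) * exp (- ((Y x / \<delta>)\<^sup>2) / 2)
        = exp (- ((X x)\<^sup>2 + (Y x)\<^sup>2) / (2 * \<delta>\<^sup>2))"
      by (simp add: power_divide add_divide_distrib diff_divide_distrib mult.commute flip: exp_add)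
    finally show ?thesis by (simp only: XY)
  qed
  have phase: "cmod (\<integral>x. E x p \<partial>gauss) \<le> 1 / sqrt (1 + (r / \<delta> * fst p)\<^sup>2) * (1 / (1 + (s / (2 * \<delta>) * snd p)\<^sup>2))" for p
  proof -
    define a b where "a = fst p / \<delta>" and "b = snd p / \<delta>"
    obtain U d k where U: "unitary U"
        "hermitian_part (u * Complex a b) M = U ** diag_matrix (\<lambda>i. complex_of_real (d i)) ** conj_transpose U"
      and d: "5 \<le> card {i. s / 2 * \<bar>b\<bar> \<le> \<bar>d i\<bar>}" "r * \<bar>a\<bar> \<le> \<bar>d k\<bar>"
      using eig[of a b] by blast
    have "E x p = iexp (Re (cinner x (hermitian_part (u * Complex a b) M *v x)))" for x
    proof -
      have "Re (cnj (u * Complex a b) * cinner x (M *v x)) = a * X x + b * Y x"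
        by (simp add: X_def Y_def algebra_simps)
      then show ?thesis
        by (simp only: E_def a_def[symmetric] b_def[symmetric] cinner_hermitian_part Re_complex_of_real)
    qed
    then have "cmod (\<integral>x. E x p \<partial>gauss) = (\<Prod>i\<in>UNIV. 1 / sqrt (1 + (d i)\<^sup>2))"
      using gauss_hermitian_phase[OF U] by simp
    also have "\<dots> \<le> 1 / sqrt (1 + (r * \<bar>a\<bar>)\<^sup>2) * (1 / (1 + (s / 2 * \<bar>b\<bar>)\<^sup>2))"
      using d r \<sigma> by (intro prod_inverse_sqrt_le[where k = k]) (auto simp: s_def)
    finally show ?thesis by (simp add: a_def b_def power_mult_distrib power_divide)
  qed
  let ?A = "{x. cmod (cinner x (M *v x)) \<le> \<delta>}"
  let ?g = "\<lambda>x. exp (- (cmod (cinner x (M *v x)))\<^sup>2 / (2 * \<delta>\<^sup>2))"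
  let ?f1 = "\<lambda>a. 1 / sqrt (1 + (r / \<delta> * a)\<^sup>2)" and ?f2 = "\<lambda>b. 1 / (1 + (s / (2 * \<delta>) * b)\<^sup>2)"
  have le1: "\<bar>1 / sqrt (1 + y\<^sup>2)\<bar> \<le> 1" "\<bar>1 / (1 + y\<^sup>2)\<bar> \<le> 1" for y :: real
    by (simp_all add: divide_le_eq_1 add_pos_nonneg)
  have f12: "integrable (N \<Otimes>\<^sub>M N) (\<lambda>p. ?f1 (fst p) * ?f2 (snd p))"
  proof (rule NN.integrable_const_bound[where B = 1])
    have "norm (?f1 a * ?f2 b) \<le> 1 * 1" for a b
      unfolding real_norm_def abs_mult by (intro mult_mono le1) auto
    then show "AE p in N \<Otimes>\<^sub>M N. norm (?f1 (fst p) * ?f2 (snd p)) \<le> 1" by simp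
  qed simp
  have "measure gauss ?A = (\<integral>x. indicator ?A x \<partial>gauss)" by simp
  also have "\<dots> \<le> (\<integral>x. 2 * ?g x \<partial>gauss)"
  proof (rule integral_mono_AE')
    show "integrable gauss (\<lambda>x. 2 * ?g x)"
      by (rule G.integrable_const_bound[where B = 2]) simp_all
    \<comment> \<open>On the disk the Gaussian is at least exp(-1/2), hence at least 1/2: this is
      the factor 2.\<close>
    have "1 \<le> 2 * ?g x" if "cmod (cinner x (M *v x)) \<le> \<delta>" for x
    proof -
      have "(cmod (cinner x (M *v x)))\<^sup>2 \<le> \<delta>\<^sup>2" using that by (intro power_mono) auto
      then have "- (1 / 2) \<le> - (cmod (cinner x (M *v x)))\<^sup>2 / (2 * \<delta>\<^sup>2)"
        using \<delta> by (simp add: field_simps)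
      moreover have "1 + - (1 / 2) \<le> exp (- (1 / 2) :: real)" by (rule exp_ge_add_one_self)
      moreover have "exp (- (1 / 2)) \<le> ?g x" using calculation(1) by simp
      ultimately show ?thesis by linarith
    qed
    then show "AE x in gauss. indicator ?A x \<le> 2 * ?g x"
      by (auto simp: indicator_def)
  qed simp
  also have "\<dots> = 2 * (\<integral>x. ?g x \<partial>gauss)" by simp
  also have "(\<integral>x. ?g x \<partial>gauss) = cmod (complex_of_real (\<integral>x. ?g x \<partial>gauss))"
    by (simp add: integral_nonneg_AE)
  also have "complex_of_real (\<integral>x. ?g x \<partial>gauss) = (\<integral>x. (\<integral>p. E x p \<partial>(N \<Otimes>\<^sub>M N)) \<partial>gauss)"
    unfolding char_E by (rule integral_complex_of_real[symmetric])
  also have "\<dots> = (\<integral>p. (\<integral>x. E x p \<partial>gauss) \<partial>(N \<Otimes>\<^sub>M N))"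
    by (rule GN.Fubini_integral[symmetric, OF int_E])
  also have "cmod \<dots> \<le> (\<integral>p. cmod (\<integral>x. E x p \<partial>gauss) \<partial>(N \<Otimes>\<^sub>M N))"
    by (rule integral_norm_bound)
  also have "\<dots> \<le> (\<integral>p. ?f1 (fst p) * ?f2 (snd p) \<partial>(N \<Otimes>\<^sub>M N))"
    using f12 phase by (intro integral_mono_AE') auto
  also have "\<dots> = (\<integral>a. (\<integral>b. ?f1 a * ?f2 b \<partial>N) \<partial>N)"
    using NN.integral_fst'[OF f12] by simp
  also have "\<dots> = (\<integral>a. ?f1 a \<partial>N) * (\<integral>b. ?f2 b \<partial>N)"
    by (simp only: integral_mult_right_zero integral_mult_left_zero)
  \<comment> \<open>The second factor equals \<open>4 * \<delta> / s\<close>; with the factor 2 from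
    the domination this produces the constant 8.\<close>
  also have "\<dots> \<le> (arsinh (r / \<delta>) + 1) / (r / \<delta>) * (2 / (s / (2 * \<delta>)))"
    using r \<sigma> \<delta> unfolding N_def s_def
    by (intro mult_mono std_normal_inverse_sqrt_le std_normal_inverse_square_le)
      (auto intro!: integral_nonneg_AE mult_nonneg_nonneg divide_nonneg_nonneg add_nonneg_nonneg arsinh_real_nonneg)
  finally show ?thesis
    using r \<sigma> \<delta> by (simp add: s_def power2_eq_square field_simps)
qed

section \<open>Passage to the sphere and the final constants\<close>

lemma cmod_numerical_range_le:
  assumes "z \<in> numerical_range M"
  shows "cmod z \<le> op_norm M"
proof -
  obtain x where x: "z = cinner x (M *v x)" "norm x = 1"
    using assms by (auto simp: numerical_range_def)
  have "cmod z \<le> norm x * norm (M *v x)"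
    unfolding x(1) by (rule cmod_cinner_le)
  also have "norm (M *v x) \<le> op_norm M * norm x"
    unfolding op_norm_def
    by (intro onorm linear_linear[THEN iffD2] linear_matrix_vector)
  finally show ?thesis using x(2) by simp
qed

text \<open>Moving from the centre away from the origin by \<open>t * r\<close> reaches modulus
  \<open>cmod c + t * r\<close>. This later bounds the argument of \<open>arsinh\<close> in terms of
  the operator norm.\<close>

lemma ball_numerical_range_radius_le:
  assumes ball: "ball c r \<subseteq> numerical_range M" and "0 < r"
  shows "r \<le> op_norm M"
proof (rule field_le_mult_one_interval)
  fix t :: real assume t: "0 < t" "t < 1"
  define v where "v = (if c = 0 then 1 else sgn c)"
  have v: "cmod v = 1" "c = complex_of_real (cmod c) * v"
    by (simp add: v_def norm_sgn, simp add: v_def sgn_eq)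
  have "c + complex_of_real (t * r) * v \<in> ball c r"
    using t \<open>0 < r\<close> v by (simp add: dist_norm norm_mult)
  then have "cmod (c + complex_of_real (t * r) * v) \<le> op_norm M"
    using ball cmod_numerical_range_le by blast
  moreover have "c + complex_of_real (t * r) * v = complex_of_real (cmod c + t * r) * v"
    by (subst v(2)) (simp add: algebra_simps)
  ultimately have "\<bar>cmod c + t * r\<bar> \<le> op_norm M"
    by (simp only: norm_mult v(1) norm_of_real mult_1_right)
  then show "t * r \<le> op_norm M" using norm_ge_zero[of c] by linarith
qed

text \<open>On the ball the squared norm is at most 2n, so a form of modulus at most
  \<open>\<epsilon>\<close> at the direction is at most \<open>\<delta> = 2 * n * \<epsilon>\<close>
  at the vector. Then \<open>8 * \<delta>\<^sup>2\<close> is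
  \<open>32 * n\<^sup>2 * \<epsilon>\<^sup>2\<close>, doubled by the conditioning.\<close>

lemma haar_small_ball:
  fixes M :: "complex ^ 'n ^ 'n"
  assumes \<mu>: "haar_sphere \<mu>" and \<epsilon>: "0 < \<epsilon>"
    and \<sigma>: "singular_value 9 M > 0" and ball: "ball c r \<subseteq> numerical_range M" and r: "0 < r"
  defines "n \<equiv> real CARD('n)"
  shows "measure \<mu> {x. cmod (cinner x (M *v x)) \<le> \<epsilon>}
    \<le> 64 * n\<^sup>2 * \<epsilon>\<^sup>2 * (arsinh (r / (2 * n * \<epsilon>)) + 1) / (singular_value 9 M * r)"
proof -
  interpret G: prob_space "gauss :: (complex ^ 'n) measure" by (rule prob_space_gauss)
  have n: "9 \<le> CARD('n)" by (rule singular_value_pos_le_card[OF \<sigma>])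
  define \<delta> where "\<delta> = 2 * n * \<epsilon>"
  have \<delta>: "0 < \<delta>" using \<epsilon> n by (simp add: \<delta>_def n_def)
  let ?B = "cball 0 (sqrt (2 * n)) :: (complex ^ 'n) set"
  let ?A = "{x. cmod (cinner x (M *v x)) \<le> \<epsilon>}"
  have half: "1 / 2 \<le> measure gauss ?B"
  proof -
    have "norm x \<le> sqrt (2 * n) \<longleftrightarrow> (norm x)\<^sup>2 \<le> 2 * n" for x :: "complex ^ 'n"
      using real_sqrt_le_iff[of "(norm x)\<^sup>2" "2 * n"] by simp
    then have "?B = space gauss - {x. 2 * n < (norm x)\<^sup>2}"
      by (auto simp: not_less)
    then have "measure gauss ?B = 1 - measure gauss {x :: complex ^ 'n. 2 * n < (norm x)\<^sup>2}"
      using G.prob_compl[of "{x. 2 * n < (norm x)\<^sup>2}"] by simp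
    moreover have "measure gauss {x :: complex ^ 'n. 2 * n < (norm x)\<^sup>2} \<le> 1 / 2"
    proof -
      \<comment> \<open>The tail beyond 2n is at most (2/e)^n, and 2/e is at most 4/5; dimension at
        least 9 brings this below 1/2.\<close>
      have "5 / 2 \<le> exp (1 :: real)" using exp_lower_Taylor_quadratic[of 1] by simp
      then have "2 * exp (- 1) \<le> (4 / 5 :: real)" by (simp add: exp_minus field_simps)
      then have "(2 * exp (- 1)) ^ CARD('n) \<le> (4 / 5 :: real) ^ CARD('n)"
        by (intro power_mono) auto
      also have "\<dots> \<le> (4 / 5) ^ 9" using n by (intro power_decreasing) auto
      also have "\<dots> \<le> (1 / 2 :: real)" by (simp add: power_divide)
      finally have "2 ^ CARD('n) * exp (- (2 * n / 2)) \<le> 1 / 2"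
        by (simp add: power_mult_distrib n_def flip: exp_of_nat_mult)
      then show ?thesis using gauss_tail[of "2 * n", where 'n = 'n] by linarith
    qed
    ultimately show ?thesis by simp
  qed
  have [measurable]: "(sgn :: complex ^ 'n \<Rightarrow> _) \<in> borel_measurable borel"
    unfolding sgn_div_norm[abs_def] by measurable
  have [measurable]: "?A \<in> sets borel" by measurable
  have sgnA: "sgn -` ?A \<in> sets borel"
    using measurable_sets[of "sgn :: complex ^ 'n \<Rightarrow> _" borel borel ?A] by simp
  have "\<mu> = distr (uniform_measure gauss ?B) borel sgn"
    using half by (intro haar_sphere_unique \<mu> haar_sphere_gauss_cball) simp
  then have "measure \<mu> ?A = measure (uniform_measure gauss ?B) (sgn -` ?A)"
    by (simp add: measure_distr)
  also have "\<dots> = measure gauss (?B \<inter> sgn -` ?A) / measure gauss ?B"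
    using half sgnA by (subst measure_uniform_measure) (auto simp: measure_def)
  also have "\<dots> \<le> measure gauss {x. cmod (cinner x (M *v x)) \<le> \<delta>} / (1 / 2)"
  proof (rule frac_le)
    show "measure gauss (?B \<inter> sgn -` ?A) \<le> measure gauss {x. cmod (cinner x (M *v x)) \<le> \<delta>}"
    proof (rule G.finite_measure_mono)
      show "?B \<inter> sgn -` ?A \<subseteq> {x. cmod (cinner x (M *v x)) \<le> \<delta>}"
      proof
        fix x assume x: "x \<in> ?B \<inter> sgn -` ?A"
        have "x = complex_of_real (norm x) *s sgn x"
          by (cases "x = 0") (simp_all add: sgn_div_norm flip: scaleR_eq_scale)
        then have "cinner x (M *v x) = complex_of_real ((norm x)\<^sup>2) * cinner (sgn x) (M *v sgn x)"
          by (metis (no_types, lifting) cinner_scale_left cinner_scale_right complex_cnj_complex_of_real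
              mult.assoc of_real_mult power2_eq_square vec.scale)
        then have "cmod (cinner x (M *v x)) = (norm x)\<^sup>2 * cmod (cinner (sgn x) (M *v sgn x))"
          by (simp only: norm_mult norm_of_real) simp
        also have "\<dots> \<le> 2 * n * \<epsilon>"
        proof (rule mult_mono)
          have "(norm x)\<^sup>2 \<le> (sqrt (2 * n))\<^sup>2" using x by (intro power_mono) auto
          then show "(norm x)\<^sup>2 \<le> 2 * n" by (simp add: n_def)
        qed (use x in \<open>auto simp: n_def\<close>)
        finally show "x \<in> {x. cmod (cinner x (M *v x)) \<le> \<delta>}" by (simp add: \<delta>_def)
      qed
    qed simp
  qed (use half in auto)
  also have "\<dots> \<le> 8 * \<delta>\<^sup>2 * (arsinh (r / \<delta>) + 1) / (singular_value 9 M * r) / (1 / 2)"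
    by (intro divide_right_mono gauss_small_ball[OF \<sigma> ball r \<delta>]) simp
  finally show ?thesis by (simp add: \<delta>_def power_mult_distrib algebra_simps)
qed

text \<open>The constant 4e is made for \<open>L = ln (4 * x) + 1\<close>, so one factor
  \<open>L\<close> absorbs \<open>arsinh k + 1\<close>. The other enters as
  \<open>2 \<le> L\<close>, and \<open>n + 3\<close> being at least 12 pays for the rest of
  64.\<close>

lemma log_factor_bound:
  fixes x n k :: real
  assumes x: "1 < x" and n: "9 \<le> n" and k: "0 < k" "k \<le> x / (2 * n)"
  shows "64 * n\<^sup>2 * (arsinh k + 1) \<le> (ln (4 * exp 1 * x))\<^sup>2 * (5.1 * (n + 3) ^ 3)"
proof -
  define L where "L = ln (4 * exp 1 * x)"
  have "k \<le> x / 2" using k n x by (smt (verit) divide_left_mono mult_pos_pos)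
  moreover have "sqrt (k\<^sup>2 + 1) \<le> k + 1"
    using k by (intro real_le_lsqrt) (auto simp: power2_eq_square algebra_simps)
  ultimately have "k + sqrt (k\<^sup>2 + 1) \<le> 4 * x" using x by linarith
  then have "arsinh k \<le> ln (4 * x)"
    unfolding arsinh_real_def using arsinh_real_aux[of k] x by simp
  moreover have L_eq: "L = ln (4 * x) + 1"
    using x by (simp add: L_def ln_mult)
  ultimately have le: "arsinh k + 1 \<le> L" by simp
  have "exp 1 * 1 \<le> 4 * x" using exp_le x by (intro mult_mono) auto
  then have "ln (exp 1) \<le> ln (4 * x)" using x by (subst ln_le_cancel_iff) auto
  then have L: "2 \<le> L" using L_eq by simp
  have "64 * n\<^sup>2 \<le> 2 * (5.1 * (12 * n\<^sup>2))" by simp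
  also have "\<dots> \<le> 2 * (5.1 * ((n + 3) * (n + 3)\<^sup>2))"
    using n by (intro mult_left_mono mult_mono power_mono) auto
  also have "\<dots> = 2 * (5.1 * (n + 3) ^ 3)" by (simp add: power3_eq_cube power2_eq_square)
  also have "\<dots> \<le> L * (5.1 * (n + 3) ^ 3)"
    using L n by (intro mult_right_mono) auto
  finally have "64 * n\<^sup>2 * (arsinh k + 1) \<le> L * (5.1 * (n + 3) ^ 3) * L"
    by (rule mult_mono[OF _ le]) (use L n k arsinh_real_nonneg[of k] in auto)
  then show ?thesis by (simp add: L_def power2_eq_square mult_ac)
qed


theorem proposition4p11:
  fixes M :: "complex ^ 'n ^ 'n"
    and \<epsilon> :: real
    and P :: "'a measure"
    and q :: "'a \<Rightarrow> complex ^ 'n"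
  assumes "M \<noteq> 0"
    and "0 < \<epsilon>" and "\<epsilon> < op_norm M"
    and "prob_space P"
    and "q \<in> borel_measurable P"
    and "haar_sphere (distr P borel q)"
  shows "ereal (measure P {\<omega> \<in> space P. cmod (cinner (q \<omega>) (M *v q \<omega>)) \<le> \<epsilon>})
    \<le> ereal (\<epsilon>\<^sup>2 * (ln (4 * exp 1 * op_norm M / \<epsilon>))\<^sup>2) *
       (ereal (5.1 * (real CARD('n) + 3) ^ 3) /
        (ereal (singular_value 9 M) * inner_radius (numerical_range M)))"
proof -
  define p where "p = measure P {\<omega> \<in> space P. cmod (cinner (q \<omega>) (M *v q \<omega>)) \<le> \<epsilon>}"
  define \<sigma> where "\<sigma> = singular_value 9 M"
  define I where "I = inner_radius (numerical_range M)"
  define a where "a = \<epsilon>\<^sup>2 * (ln (4 * exp 1 * op_norm M / \<epsilon>))\<^sup>2"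
  define b where "b = 5.1 * (real CARD('n) + 3) ^ 3"
  have [measurable]: "q \<in> borel_measurable P" by fact
  have p_eq: "p = measure (distr P borel q) {x. cmod (cinner x (M *v x)) \<le> \<epsilon>}"
    unfolding p_def by (subst measure_distr) (auto simp: vimage_def Int_def conj_commute)
  have p0: "0 \<le> p" by (simp add: p_def)
  have \<sigma>0: "0 \<le> \<sigma>" by (simp add: \<sigma>_def singular_value_nonneg)
  have I0: "0 \<le> I"
    unfolding I_def inner_radius_def by (rule Sup_upper) (auto simp: zero_ereal_def intro!: exI[of _ 0])
  have b0: "0 < b" by (simp add: b_def)
  \<comment> \<open>Strict positivity of \<open>a\<close> matters: in \<open>ereal\<close> the
    product of 0 and infinity is 0, so a vanishing \<open>a\<close> would spoil the case of a zero
    denominator.\<close>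
  have "1 < 4 * exp 1 * op_norm M / \<epsilon>"
  proof -
    have "1 < op_norm M / \<epsilon>" using assms(2,3) by simp
    moreover have "1 \<le> 4 * exp (1 :: real)" using exp_ge_add_one_self[of 1] by simp
    ultimately have "1 * 1 < (4 * exp 1) * (op_norm M / \<epsilon>)" by (intro mult_le_less_imp_less) auto
    then show ?thesis by simp
  qed
  then have "0 < ln (4 * exp 1 * op_norm M / \<epsilon>)" by (rule ln_gt_zero)
  then have a0: "0 < a"
    unfolding a_def using assms(2) by (intro mult_pos_pos zero_less_power)
  have key: "p \<le> a * b / (\<sigma> * r)" if "0 < \<sigma>" and ball: "ball c r \<subseteq> numerical_range M" and r: "0 < r" for c r
  proof -
    have \<sigma>: "0 < singular_value 9 M" using \<open>0 < \<sigma>\<close> by (simp add: \<sigma>_def)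
    define n where "n = real CARD('n)"
    define k where "k = r / (2 * n * \<epsilon>)"
    have n: "9 \<le> n" using singular_value_pos_le_card[OF \<sigma>] by (simp add: n_def)
    have "k \<le> op_norm M / \<epsilon> / (2 * n)"
      using ball_numerical_range_radius_le[OF ball r] n assms(2) by (simp add: k_def field_simps)
    then have "64 * n\<^sup>2 * (arsinh k + 1) \<le> (ln (4 * exp 1 * (op_norm M / \<epsilon>)))\<^sup>2 * (5.1 * (n + 3) ^ 3)"
      using assms(2,3) n r by (intro log_factor_bound) (auto simp: k_def)
    then have "\<epsilon>\<^sup>2 * (64 * n\<^sup>2 * (arsinh k + 1)) \<le> a * b"
      using mult_left_mono[of _ _ "\<epsilon>\<^sup>2"] by (simp add: a_def b_def n_def mult.assoc)
    then have "64 * n\<^sup>2 * \<epsilon>\<^sup>2 * (arsinh k + 1) / (\<sigma> * r) \<le> a * b / (\<sigma> * r)"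
      using \<open>0 < \<sigma>\<close> r by (intro divide_right_mono) (simp_all add: mult_ac)
    moreover have "p \<le> 64 * n\<^sup>2 * \<epsilon>\<^sup>2 * (arsinh k + 1) / (\<sigma> * r)"
      unfolding p_eq k_def n_def \<sigma>_def by (rule haar_small_ball[OF assms(6,2) \<sigma> ball r])
    ultimately show ?thesis by simp
  qed
  have "ereal p \<le> ereal a * (ereal b / (ereal \<sigma> * I))"
  proof (cases "\<sigma> = 0 \<or> I = 0 \<or> p = 0")
    case True
    show ?thesis
    proof (cases "p = 0")
      case True
      then show ?thesis
        using a0 b0 \<sigma>0 I0 by (simp flip: zero_ereal_def)
    next
      case False
      with True have zero: "ereal \<sigma> * I = 0" by auto
      show ?thesis unfolding zero using a0 b0 by (simp add: divide_ereal_def)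
    qed
  next
    case False
    then have pos: "0 < \<sigma>" "0 < I" "0 < p" using \<sigma>0 I0 p0 by auto
    \<comment> \<open>Solved for \<open>r\<close>, which requires \<open>p\<close> to be positive,
      \<open>key\<close> bounds every radius and so the supremum, whether or not it is attained. It
      also shows that \<open>I\<close> is finite.\<close>
    have "I \<le> ereal (a * b / (p * \<sigma>))"
      unfolding I_def inner_radius_def
    proof (rule Sup_least, clarsimp)
      fix r c assume r: "0 \<le> r" and ball: "ball c r \<subseteq> numerical_range M"
      show "r \<le> a * b / (p * \<sigma>)"
      proof (cases "r = 0")
        case True
        then show ?thesis using a0 b0 pos by simp
      next
        case False
        then show ?thesis using key[OF pos(1) ball] r pos by (simp add: field_simps)
      qed
    qed
    then obtain R where R: "I = ereal R" "0 < R" "R \<le> a * b / (p * \<sigma>)"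
      using pos(2) by (cases I) auto
    then have "p \<le> a * (b / (\<sigma> * R))"
      using pos by (simp add: field_simps)
    then show ?thesis using R pos by simp
  qed
  then show ?thesis unfolding p_def \<sigma>_def I_def a_def b_def .
qed

end
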